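(* Let $\mathbb{K}$ be an algebraically closed field of characteristic zero and let $n\ge 2$ be an integer. If $\mathcal{H}$ is a closed subgroup of $\mathcal{G}=\mathrm{GA}_n(\mathbb{K})$ (for the inductive limit topology) which strictly contains the affine subgroup $\mathcal{A}=\mathrm{Aff}_n(\mathbb{K})$, then $\mathcal{T}\subset\mathcal{H}$, where $\mathcal{T}=\mathrm{TA}_n(\mathbb{K})$ is the tame subgroup.
   Context: Let $\mathcal{E}=\mathrm{End}_n(\mathbb{K})$ be the set $(\mathbb{K}[x_1,\ldots,x_n])^n$ endowed with the composition law $\sigma\tau=(f_1(g_1,\ldots,g_n),\ldots,f_n(g_1,\ldots,g_n))$ for $\sigma=(f_1,\ldots,f_n)$ and $\tau=(g_1,\ldots,g_n)$; it is a monoid with identity $\mathrm{id}=(x_1,\ldots,x_n)$. Let $\mathcal{G}=\mathrm{GA}_n(\mathbb{K})$ be the group of invertible elements of $\mathcal{E}$. The degree of $\sigma=(f_1,\ldots,f_n)\in\mathcal{E}$ is $\deg(\sigma)=\max_{1\le i\le n}\deg(f_i)$. The affine subgroup is $\mathcal{A}=\mathrm{Aff}_n(\mathbb{K})=\{\sigma\in\mathcal{G} : \deg(\sigma)=1\}$. The triangular subgroup is $\mathcal{B}=\mathrm{BA}_n(\mathbb{K})=\{(\alpha_1x_1+p_1,\ldots,\alpha_nx_n+p_n) : \alpha_i\in\mathbb{K}^*,\ p_i\in\mathbb{K}[x_{i+1},\ldots,x_n]\text{ for all } i\}$ (so $p_n\in\mathbb{K}$). The tame subgroup $\mathcal{T}=\mathrm{TA}_n(\mathbb{K})$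 is the subgroup of $\mathcal{G}$ generated by $\mathcal{A}$ and $\mathcal{B}$. Topology: for each positive integer $d$, the set $\mathcal{E}_{\le d}$ of elements of $\mathcal{E}$ of degree $\le d$ is a finite-dimensional $\mathbb{K}$-vector space, regarded as an affine space and endowed with the Zariski topology; $\mathcal{E}_{\le d}$ is closed in $\mathcal{E}_{\le d+1}$. The set $\mathcal{E}=\bigcup_{d\ge 1}\mathcal{E}_{\le d}$ carries the inductive limit topology: $A\subset\mathcal{E}$ is closed if and only if $A\cap\mathcal{E}_{\le d}$ is closed in $\mathcal{E}_{\le d}$ for every $d\ge 1$. The group $\mathcal{G}$ carries the subspace topology induced from $\mathcal{E}$. *)

theory Defs
  imports
    "HOL-Library.Cardinality"
    "HOL-Library.Poly_Mapping"
    "HOL-Computational_Algebra.Polynomial"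
    "HOL-Algebra.Generated_Groups"
    "HOL-Analysis.Abstract_Topology"
begin

section \<open>Multivariate polynomials\<close>

text \<open>
  A polynomial with variables indexed by \<open>'v\<close> maps each monomial, i.e. each finitely supported
  exponent vector \<open>'v \<Rightarrow>\<^sub>0 nat\<close>, to its coefficient. The product of \<open>Poly_Mapping\<close> is the
  convolution product, so this is the usual polynomial ring.
\<close>

type_synonym ('v, 'k) mpoly = "('v \<Rightarrow>\<^sub>0 nat) \<Rightarrow>\<^sub>0 'k"

definition Var :: "'v \<Rightarrow> ('v, 'k::comm_ring_1) mpoly" where
  "Var i = Poly_Mapping.single (Poly_Mapping.single i 1) 1"

definition Const :: "'k \<Rightarrow> ('v, 'k::comm_ring_1) mpoly" where
  "Const c = Poly_Mapping.single 0 c"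

definition vars :: "('v, 'k::zero) mpoly \<Rightarrow> 'v set" where
  "vars p = (\<Union>m \<in> Poly_Mapping.keys p. Poly_Mapping.keys m)"

definition mdeg :: "('v \<Rightarrow>\<^sub>0 nat) \<Rightarrow> nat" where
  "mdeg m = (\<Sum>i \<in> Poly_Mapping.keys m. Poly_Mapping.lookup m i)"

text \<open>The zero polynomial gets degree 0 here; this does not affect \<open>deg \<le> d\<close> for \<open>d \<ge> 1\<close>.\<close>

definition total_deg :: "('v, 'k::zero) mpoly \<Rightarrow> nat" where
  "total_deg p = Max (insert 0 (mdeg ` Poly_Mapping.keys p))"

definition monom_eval :: "('v \<Rightarrow> 'r::comm_ring_1) \<Rightarrow> ('v \<Rightarrow>\<^sub>0 nat) \<Rightarrow> 'r" where
  "monom_eval f m = (\<Prod>i \<in> Poly_Mapping.keys m. f i ^ Poly_Mapping.lookup m i)"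

text \<open>
  \<open>eval_hom \<phi> f\<close> sends coefficients through \<open>\<phi>\<close> and the variable \<open>i\<close> to \<open>f i\<close>.
\<close>

definition eval_hom ::
    "('k::comm_ring_1 \<Rightarrow> 'r::comm_ring_1) \<Rightarrow> ('v \<Rightarrow> 'r) \<Rightarrow> ('v, 'k) mpoly \<Rightarrow> 'r" where
  "eval_hom \<phi> f p = (\<Sum>m \<in> Poly_Mapping.keys p. \<phi> (Poly_Mapping.lookup p m) * monom_eval f m)"

definition peval :: "('v \<Rightarrow> 'k) \<Rightarrow> ('v, 'k::comm_ring_1) mpoly \<Rightarrow> 'k" where
  "peval = eval_hom (\<lambda>c. c)"

definition psubst :: "('v \<Rightarrow> ('w, 'k) mpoly) \<Rightarrow> ('v, 'k::comm_ring_1) mpoly \<Rightarrow> ('w, 'k) mpoly" where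
  "psubst = eval_hom Const"

lemma monom_eval_superset:
  assumes "finite A" "Poly_Mapping.keys m \<subseteq> A"
  shows "monom_eval f m = (\<Prod>i\<in>A. f i ^ Poly_Mapping.lookup m i)"
  unfolding monom_eval_def
  by (rule prod.mono_neutral_left) (use assms in \<open>auto simp: in_keys_iff\<close>)

lemma monom_eval_0 [simp]: "monom_eval f 0 = 1"
  by (simp add: monom_eval_def)

lemma monom_eval_single [simp]: "monom_eval f (Poly_Mapping.single i k) = f i ^ k"
  by (simp add: monom_eval_def)

lemma monom_eval_add: "monom_eval f (m + m') = monom_eval f m * monom_eval f m'"
proof -
  let ?A = "Poly_Mapping.keys m \<union> Poly_Mapping.keys m'"
  have "Poly_Mapping.keys (m + m') \<subseteq> ?A" by (rule Poly_Mapping.keys_add)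
  then show ?thesis
    by (simp add: monom_eval_superset[of ?A] lookup_add power_add prod.distrib)
qed

lemma mpoly_sum_single:
  "p = (\<Sum>m \<in> Poly_Mapping.keys p. Poly_Mapping.single m (Poly_Mapping.lookup p m))"
proof (rule poly_mapping_eqI)
  fix k
  show "Poly_Mapping.lookup p k = Poly_Mapping.lookup
      (\<Sum>m \<in> Poly_Mapping.keys p. Poly_Mapping.single m (Poly_Mapping.lookup p m)) k"
    by (auto simp: lookup_sum lookup_single when_def in_keys_iff)
qed

locale coeff_hom =
  fixes \<phi> :: "'k::comm_ring_1 \<Rightarrow> 'r::comm_ring_1"
  assumes hom_0: "\<phi> 0 = 0" and hom_1: "\<phi> 1 = 1"
    and hom_add: "\<phi> (a + b) = \<phi> a + \<phi> b" and hom_mult: "\<phi> (a * b) = \<phi> a * \<phi> b"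
begin

lemma eval_hom_superset:
  assumes "finite A" "Poly_Mapping.keys p \<subseteq> A"
  shows "eval_hom \<phi> f p = (\<Sum>m\<in>A. \<phi> (Poly_Mapping.lookup p m) * monom_eval f m)"
  unfolding eval_hom_def
  by (rule sum.mono_neutral_left) (use assms in \<open>auto simp: in_keys_iff hom_0\<close>)

lemma eval_hom_0: "eval_hom \<phi> f 0 = 0"
  by (simp add: eval_hom_def)

lemma eval_hom_single: "eval_hom \<phi> f (Poly_Mapping.single m c) = \<phi> c * monom_eval f m"
  by (cases "c = 0") (simp_all add: eval_hom_def hom_0)

lemma eval_hom_1: "eval_hom \<phi> f 1 = 1"
  using eval_hom_single[of f 0 1] by (simp add: hom_1)

lemma eval_hom_add: "eval_hom \<phi> f (p + q) = eval_hom \<phi> f p + eval_hom \<phi> f q"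
proof -
  let ?A = "Poly_Mapping.keys p \<union> Poly_Mapping.keys q"
  have "Poly_Mapping.keys (p + q) \<subseteq> ?A" by (rule Poly_Mapping.keys_add)
  then show ?thesis
    by (simp add: eval_hom_superset[of ?A] lookup_add hom_add distrib_right sum.distrib)
qed

lemma eval_hom_sum: "eval_hom \<phi> f (sum g A) = (\<Sum>a\<in>A. eval_hom \<phi> f (g a))"
  by (induction A rule: infinite_finite_induct) (simp_all add: eval_hom_0 eval_hom_add)

lemma eval_hom_mult: "eval_hom \<phi> f (p * q) = eval_hom \<phi> f p * eval_hom \<phi> f q"
proof -
  let ?s = "\<lambda>p m. Poly_Mapping.single m (Poly_Mapping.lookup p m)"
  have "eval_hom \<phi> f (p * q) = eval_hom \<phi> f
      ((\<Sum>m \<in> Poly_Mapping.keys p. ?s p m) * (\<Sum>m \<in> Poly_Mapping.keys q. ?s q m))"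
    using mpoly_sum_single[of p] mpoly_sum_single[of q] by simp
  also have "\<dots> = (\<Sum>m \<in> Poly_Mapping.keys p. \<Sum>m' \<in> Poly_Mapping.keys q.
      (\<phi> (Poly_Mapping.lookup p m) * monom_eval f m) *
      (\<phi> (Poly_Mapping.lookup q m') * monom_eval f m'))"
    by (simp add: sum_product eval_hom_sum mult_single eval_hom_single hom_mult
        monom_eval_add mult_ac)
  also have "\<dots> = eval_hom \<phi> f p * eval_hom \<phi> f q"
    by (simp add: eval_hom_def sum_product)
  finally show ?thesis .
qed

lemma eval_hom_power: "eval_hom \<phi> f (p ^ k) = eval_hom \<phi> f p ^ k"
  by (induction k) (simp_all add: eval_hom_1 eval_hom_mult)

lemma eval_hom_prod: "eval_hom \<phi> f (prod g A) = (\<Prod>a\<in>A. eval_hom \<phi> f (g a))"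
  by (induction A rule: infinite_finite_induct) (simp_all add: eval_hom_1 eval_hom_mult)

end

interpretation peval: coeff_hom "\<lambda>c. c"
  rewrites "eval_hom (\<lambda>c. c) = peval"
  by unfold_locales (simp_all add: peval_def)

interpretation psubst: coeff_hom Const
  rewrites "eval_hom Const = psubst"
  by unfold_locales (simp_all add: psubst_def Const_def single_add mult_single)

lemma psubst_psubst:
  fixes p :: "('v, 'k::comm_ring_1) mpoly" and g :: "'v \<Rightarrow> ('w, 'k) mpoly"
    and h :: "'w \<Rightarrow> ('u, 'k) mpoly"
  shows "psubst h (psubst g p) = psubst (\<lambda>i. psubst h (g i)) p"
proof -
  have C: "psubst h (Const c) = Const c" for c
    using psubst.eval_hom_single[of h 0 c] by (simp add: Const_def)
  have M: "psubst h (monom_eval g m) = monom_eval (\<lambda>i. psubst h (g i)) m" for m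
    by (simp add: monom_eval_def psubst.eval_hom_prod psubst.eval_hom_power)
  have E: "psubst f p = (\<Sum>m \<in> Poly_Mapping.keys p.
      Const (Poly_Mapping.lookup p m) * monom_eval f m)" for f :: "'v \<Rightarrow> ('u, 'k) mpoly"
    unfolding psubst_def eval_hom_def ..
  have E': "psubst g p = (\<Sum>m \<in> Poly_Mapping.keys p.
      Const (Poly_Mapping.lookup p m) * monom_eval g m)"
    unfolding psubst_def eval_hom_def ..
  show ?thesis
    unfolding E' E psubst.eval_hom_sum psubst.eval_hom_mult C M ..
qed

lemma psubst_Var: "psubst f (Var i) = f i"
  by (simp add: Var_def psubst.eval_hom_single psubst.hom_1)

lemma psubst_Var_id:
  fixes p :: "('v, 'k::comm_ring_1) mpoly"
  shows "psubst Var p = p"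
proof -
  have *: "monom_eval Var m = Poly_Mapping.single m (1::'k)" for m :: "'v \<Rightarrow>\<^sub>0 nat"
  proof -
    have pow: "(Var i :: ('v, 'k) mpoly) ^ k = Poly_Mapping.single (Poly_Mapping.single i k) 1"
      for i k
      by (induction k) (simp_all add: Var_def mult_single single_add[symmetric])
    have prod: "(\<Prod>i\<in>A. Poly_Mapping.single (g i) (1::'k)) = Poly_Mapping.single (\<Sum>i\<in>A. g i) 1"
      for A :: "'v set" and g :: "'v \<Rightarrow> ('v \<Rightarrow>\<^sub>0 nat)"
      by (induction A rule: infinite_finite_induct) (simp_all add: mult_single)
    show ?thesis
      unfolding monom_eval_def pow prod mpoly_sum_single[of m, symmetric] ..
  qed
  show ?thesis
    unfolding psubst_def eval_hom_def * Const_def mult_single add_0_left mult_1_right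
    by (rule mpoly_sum_single[symmetric])
qed

lemma vars_mult: "vars (p * q) \<subseteq> vars p \<union> vars q"
proof
  fix i assume "i \<in> vars (p * q)"
  then obtain m where m: "m \<in> Poly_Mapping.keys (p * q)" "i \<in> Poly_Mapping.keys m"
    by (auto simp: vars_def)
  then obtain a b where ab: "a \<in> Poly_Mapping.keys p" "b \<in> Poly_Mapping.keys q" "m = a + b"
    using Poly_Mapping.keys_mult[of p q] by blast
  then show "i \<in> vars p \<union> vars q"
    using m(2) Poly_Mapping.keys_add[of a b] by (auto simp: vars_def)
qed


section \<open>Polynomial endomorphisms and automorphisms of affine space\<close>

text \<open>
  The \<open>n\<close> variables \<open>x\<^sub>1, \<dots>, x\<^sub>n\<close> are indexed by a finite type \<open>'n\<close> with \<open>n = CARD('n)\<close>; its linear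
  order (used only for the triangular automorphisms) plays the role of the order on \<open>1, \<dots>, n\<close>.
  An endomorphism is a tuple of polynomials, so every function of type \<open>('n, 'k) endo\<close> is one.
\<close>

type_synonym ('n, 'k) endo = "'n \<Rightarrow> ('n, 'k) mpoly"

definition End_monoid :: "('n::finite, 'k::field) endo monoid" where
  "End_monoid = \<lparr>carrier = UNIV, mult = (\<lambda>\<sigma> \<tau> i. psubst \<tau> (\<sigma> i)), one = Var\<rparr>"

lemma monoid_End: "monoid End_monoid"
  by (rule monoidI) (simp_all add: End_monoid_def psubst_psubst psubst_Var psubst_Var_id)

definition GA :: "('n::finite, 'k::field) endo monoid" where
  "GA = units_of End_monoid"

lemma group_GA: "group GA"
  unfolding GA_def by (rule monoid.units_group[OF monoid_End])

definition endo_deg :: "('n::finite, 'k::field) endo \<Rightarrow> nat" where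
  "endo_deg \<sigma> = Max (range (\<lambda>i. total_deg (\<sigma> i)))"

definition Aff :: "('n::finite, 'k::field) endo set" where
  "Aff = {\<sigma> \<in> carrier GA. endo_deg \<sigma> = 1}"

definition BA :: "('n::{finite, linorder}, 'k::field) endo set" where
  "BA = {\<sigma>. \<exists>\<alpha> p. (\<forall>i. \<alpha> i \<noteq> 0 \<and> vars (p i) \<subseteq> {j. i < j} \<and> \<sigma> i = Const (\<alpha> i) * Var i + p i)}"

definition TA :: "('n::{finite, linorder}, 'k::field) endo set" where
  "TA = generate GA (Aff \<union> BA)"


section \<open>The inductive limit topology\<close>

definition End_le :: "nat \<Rightarrow> ('n::finite, 'k::field) endo set" where
  "End_le d = {\<sigma>. endo_deg \<sigma> \<le> d}"

text \<open>
  The coordinates of the vector space \<open>End_le d\<close> are the coefficients of the monomials of degree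
  at most \<open>d\<close> in each component.
\<close>

definition coord_indices :: "nat \<Rightarrow> ('n \<times> ('n \<Rightarrow>\<^sub>0 nat)) set" where
  "coord_indices d = {(i, m). mdeg m \<le> d}"

definition coords :: "('n, 'k::zero) endo \<Rightarrow> 'n \<times> ('n \<Rightarrow>\<^sub>0 nat) \<Rightarrow> 'k" where
  "coords \<sigma> = (\<lambda>(i, m). Poly_Mapping.lookup (\<sigma> i) m)"

definition zero_locus ::
    "nat \<Rightarrow> ('n \<times> ('n \<Rightarrow>\<^sub>0 nat), 'k) mpoly set \<Rightarrow> ('n::finite, 'k::field) endo set" where
  "zero_locus d S = {\<sigma> \<in> End_le d. \<forall>P\<in>S. peval (coords \<sigma>) P = 0}"

definition zariski_closed :: "nat \<Rightarrow> ('n::finite, 'k::field) endo set \<Rightarrow> bool" where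
  "zariski_closed d A \<longleftrightarrow> (\<exists>S. (\<forall>P\<in>S. vars P \<subseteq> coord_indices d) \<and> A = zero_locus d S)"

definition zariski_topology :: "nat \<Rightarrow> ('n::finite, 'k::field) endo topology" where
  "zariski_topology d = topology (\<lambda>U. U \<subseteq> End_le d \<and> zariski_closed d (End_le d - U))"

definition End_topology :: "('n::finite, 'k::field) endo topology" where
  "End_topology = topology (\<lambda>U. \<forall>d\<ge>1. closedin (zariski_topology d) ((UNIV - U) \<inter> End_le d))"

lemma zariski_closed_End_le: "zariski_closed d (End_le d)"
  unfolding zariski_closed_def by (rule exI[of _ "{}"]) (simp add: zero_locus_def)

lemma zariski_closed_empty: "zariski_closed d {}"
  unfolding zariski_closed_def
  by (rule exI[of _ "{1}"]) (simp add: zero_locus_def vars_def peval.eval_hom_1)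

lemma zariski_closed_Un:
  assumes "zariski_closed d A" "zariski_closed d B"
  shows "zariski_closed d (A \<union> B)"
proof -
  obtain S T where ST: "\<forall>P\<in>S. vars P \<subseteq> coord_indices d" "A = zero_locus d S"
    "\<forall>P\<in>T. vars P \<subseteq> coord_indices d" "B = zero_locus d T"
    using assms unfolding zariski_closed_def by blast
  let ?R = "{P * Q | P Q. P \<in> S \<and> Q \<in> T}"
  have "vars (P * Q) \<subseteq> coord_indices d" if "P \<in> S" "Q \<in> T" for P Q
    using that ST(1,3) vars_mult[of P Q] by (meson Un_least order_trans)
  then have "\<forall>P\<in>?R. vars P \<subseteq> coord_indices d"
    by fastforce
  moreover have "A \<union> B = zero_locus d ?R"
  proof (intro Set.set_eqI iffI)
    fix \<sigma> assume "\<sigma> \<in> A \<union> B"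
    then show "\<sigma> \<in> zero_locus d ?R"
      unfolding ST(2,4) zero_locus_def by (auto simp: peval.eval_hom_mult)
  next
    fix \<sigma> assume \<sigma>: "\<sigma> \<in> zero_locus d ?R"
    then have "peval (coords \<sigma>) P * peval (coords \<sigma>) Q = 0" if "P \<in> S" "Q \<in> T" for P Q
      using that unfolding zero_locus_def by (auto simp flip: peval.eval_hom_mult)
    then have "(\<forall>P\<in>S. peval (coords \<sigma>) P = 0) \<or> (\<forall>Q\<in>T. peval (coords \<sigma>) Q = 0)"
      by (meson mult_eq_0_iff)
    then show "\<sigma> \<in> A \<union> B"
      using \<sigma> unfolding ST(2,4) zero_locus_def by simp
  qed
  ultimately show ?thesis
    unfolding zariski_closed_def by (intro exI conjI)
qed

lemma zariski_closed_Inter: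
  assumes "\<forall>A\<in>\<A>. zariski_closed d A"
  shows "zariski_closed d (End_le d \<inter> \<Inter>\<A>)"
proof -
  have "\<forall>A\<in>\<A>. \<exists>S. (\<forall>P\<in>S. vars P \<subseteq> coord_indices d) \<and> A = zero_locus d S"
    using assms unfolding zariski_closed_def .
  then obtain S where S: "\<forall>A\<in>\<A>. (\<forall>P\<in>S A. vars P \<subseteq> coord_indices d) \<and> A = zero_locus d (S A)"
    by (rule bchoice[THEN exE])
  then have vars_S: "\<And>A. A \<in> \<A> \<Longrightarrow> \<forall>P\<in>S A. vars P \<subseteq> coord_indices d"
    and locus_S: "\<And>A. A \<in> \<A> \<Longrightarrow> zero_locus d (S A) = A"
    by simp_all
  have "End_le d \<inter> \<Inter>\<A> = End_le d \<inter> (\<Inter>A\<in>\<A>. zero_locus d (S A))"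
    by (simp add: locus_S)
  also have "\<dots> = zero_locus d (\<Union>A\<in>\<A>. S A)"
    by (auto simp: zero_locus_def)
  finally have "End_le d \<inter> \<Inter>\<A> = zero_locus d (\<Union>A\<in>\<A>. S A)" .
  moreover have "\<forall>P\<in>(\<Union>A\<in>\<A>. S A). vars P \<subseteq> coord_indices d"
    using vars_S by simp
  ultimately show ?thesis
    unfolding zariski_closed_def by (intro exI conjI)
qed

lemma istopology_zariski:
  "istopology (\<lambda>U. U \<subseteq> End_le d \<and> zariski_closed d (End_le d - U))"
  unfolding istopology_def
proof (intro conjI allI impI)
  fix S T :: "('a, 'b) endo set"
  assume "S \<subseteq> End_le d \<and> zariski_closed d (End_le d - S)"
    and "T \<subseteq> End_le d \<and> zariski_closed d (End_le d - T)"
  then show "S \<inter> T \<subseteq> End_le d" "zariski_closed d (End_le d - S \<inter> T)"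
    by (auto simp: Diff_Int intro: zariski_closed_Un)
next
  fix \<K> :: "('a, 'b) endo set set"
  assume K: "\<forall>K\<in>\<K>. K \<subseteq> End_le d \<and> zariski_closed d (End_le d - K)"
  then show "\<Union>\<K> \<subseteq> End_le d" by blast
  have "End_le d - \<Union>\<K> = End_le d \<inter> \<Inter>((\<lambda>K. End_le d - K) ` \<K>)" by blast
  then show "zariski_closed d (End_le d - \<Union>\<K>)"
    using zariski_closed_Inter[of "(\<lambda>K. End_le d - K) ` \<K>" d] K by simp
qed

lemma openin_zariski:
  "openin (zariski_topology d) U \<longleftrightarrow> U \<subseteq> End_le d \<and> zariski_closed d (End_le d - U)"
  unfolding zariski_topology_def topology_inverse'[OF istopology_zariski] ..

lemma topspace_zariski: "topspace (zariski_topology d) = End_le d"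
proof (rule subset_antisym)
  show "topspace (zariski_topology d) \<subseteq> End_le d"
    unfolding topspace_def by (rule Union_least) (simp add: openin_zariski)
  show "End_le d \<subseteq> topspace (zariski_topology d)"
    by (rule openin_subset) (simp add: openin_zariski zariski_closed_empty)
qed

lemma zariski_closed_subset: "zariski_closed d A \<Longrightarrow> A \<subseteq> End_le d"
  by (auto simp: zariski_closed_def zero_locus_def)

lemma closedin_zariski: "closedin (zariski_topology d) A \<longleftrightarrow> zariski_closed d A"
  using zariski_closed_subset[of d A]
  by (auto simp: closedin_def topspace_zariski openin_zariski double_diff)

lemma istopology_End:
  "istopology (\<lambda>U. \<forall>d\<ge>1. closedin (zariski_topology d) ((UNIV - U) \<inter> End_le d))"
  unfolding istopology_def
proof (intro conjI allI impI)
  fix S T :: "('a, 'b) endo set" and d :: nat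
  assume "\<forall>d\<ge>1. closedin (zariski_topology d) ((UNIV - S) \<inter> End_le d)"
    and "\<forall>d\<ge>1. closedin (zariski_topology d) ((UNIV - T) \<inter> End_le d)" and "1 \<le> d"
  moreover have "(UNIV - S \<inter> T) \<inter> End_le d = ((UNIV - S) \<inter> End_le d) \<union> ((UNIV - T) \<inter> End_le d)"
    by (simp add: Diff_Int Int_Un_distrib2)
  ultimately show "closedin (zariski_topology d) ((UNIV - S \<inter> T) \<inter> End_le d)"
    by (simp add: closedin_Un)
next
  fix \<K> :: "('a, 'b) endo set set" and d :: nat
  assume K: "\<forall>K\<in>\<K>. \<forall>d\<ge>1. closedin (zariski_topology d) ((UNIV - K) \<inter> End_le d)" and "1 \<le> d"
  then have "\<forall>A\<in>(\<lambda>K. (UNIV - K) \<inter> End_le d) ` \<K>. zariski_closed d A"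
    by (simp add: closedin_zariski)
  then have "zariski_closed d (End_le d \<inter> \<Inter>((\<lambda>K. (UNIV - K) \<inter> End_le d) ` \<K>))"
    by (rule zariski_closed_Inter)
  moreover have "(UNIV - \<Union>\<K>) \<inter> End_le d
      = End_le d \<inter> \<Inter>((\<lambda>K. (UNIV - K) \<inter> End_le d) ` \<K>)"
    by (intro Set.set_eqI) auto
  ultimately show "closedin (zariski_topology d) ((UNIV - \<Union>\<K>) \<inter> End_le d)"
    unfolding closedin_zariski by (simp only:)
qed

lemma closedin_End_topology:
  "closedin End_topology A \<longleftrightarrow> (\<forall>d\<ge>1. closedin (zariski_topology d) (A \<inter> End_le d))"
proof -
  have op: "openin End_topology U \<longleftrightarrow>
      (\<forall>d\<ge>1. closedin (zariski_topology d) ((UNIV - U) \<inter> End_le d))" for U :: "('a, 'b) endo set"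
    unfolding End_topology_def topology_inverse'[OF istopology_End] ..
  have "openin End_topology (UNIV :: ('a, 'b) endo set)"
    by (simp add: op)
  then have "topspace End_topology = (UNIV :: ('a, 'b) endo set)"
    by (intro top.extremum_uniqueI openin_subset)
  then show ?thesis
    by (simp add: closedin_def[of End_topology] op double_diff)
qed

end

theory Submission
  imports Defs
begin

text \<open>
  Conjugating \<open>h = id + h\<^sub>k + \<dots>\<close> by diagonal matrices \<open>diag (t ^ a)\<close> gives a polynomial family in \<open>t\<close>
  whose limit for \<open>t \<longrightarrow> 0\<close> stays in a closed subgroup; suitable weights leave only a shear
  \<open>x\<^sub>i \<mapsto> x\<^sub>i + c x\<^sub>j ^ k\<close>, where \<open>c\<close> is the coefficient of \<open>x\<^sub>j ^ k\<close> in the \<open>i\<close>-th component of \<open>h\<^sub>k\<close>. For a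
  non-affine element of the subgroup, some line is mapped to a curve \<open>\<gamma>\<close> which is not affine; since
  \<open>\<gamma>'\<close> never vanishes, \<open>\<gamma>''\<close> is not everywhere parallel to \<open>\<gamma>'\<close> (look at a root of a component of
  \<open>\<gamma>'\<close>), so after normalising the 2-jet at a suitable point of the line one obtains a quadratic shear.
  Commutators then give the shears by all powers \<open>x\<^sub>j ^ k\<close>. The polynomials \<open>p\<close> for which
  \<open>x\<^sub>i \<mapsto> x\<^sub>i + p\<close> is in the subgroup form a subspace stable under affine substitutions of the other
  variables, hence, in characteristic zero, contain all monomials in these variables.
\<close>

abbreviation lookup where "lookup \<equiv> Poly_Mapping.lookup"
abbreviation keys where "keys \<equiv> Poly_Mapping.keys"
abbreviation single where "single \<equiv> Poly_Mapping.single"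

section \<open>Substitution in multivariate polynomials\<close>

lemma (in coeff_hom) eval_hom_Const: "eval_hom \<phi> f (Const c) = \<phi> c"
  by (simp add: Const_def eval_hom_single)

lemma (in coeff_hom) eval_hom_Var: "eval_hom \<phi> f (Var i) = f i"
  by (simp add: Var_def eval_hom_single hom_1)

lemma (in coeff_hom) hom_uminus: "\<phi> (- a) = - \<phi> a"
  using hom_add[of a "- a"] by (simp add: hom_0 eq_neg_iff_add_eq_0 add.commute)

lemma (in coeff_hom) eval_hom_uminus: "eval_hom \<phi> f (- p) = - eval_hom \<phi> f p"
  using eval_hom_add[of f p "- p"] by (simp add: eval_hom_0 eq_neg_iff_add_eq_0 add.commute)

lemma (in coeff_hom) eval_hom_diff: "eval_hom \<phi> f (p - q) = eval_hom \<phi> f p - eval_hom \<phi> f q"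
  using eval_hom_add[of f p "- q"] by (simp add: eval_hom_uminus)

lemma (in coeff_hom) hom_sum: "\<phi> (sum g A) = (\<Sum>a\<in>A. \<phi> (g a))"
  by (induction A rule: infinite_finite_induct) (simp_all add: hom_0 hom_add)

lemma (in coeff_hom) hom_power: "\<phi> (a ^ k) = \<phi> a ^ k"
  by (induction k) (simp_all add: hom_1 hom_mult)

lemma (in coeff_hom) hom_prod: "\<phi> (prod g A) = (\<Prod>a\<in>A. \<phi> (g a))"
  by (induction A rule: infinite_finite_induct) (simp_all add: hom_1 hom_mult)

text \<open>Taking for \<open>\<phi>\<close> an evaluation \<open>poly _ t\<close>, a composition
  \<open>pcompose _ [:r, 1:]\<close> or another \<open>eval_hom\<close> gives the compatibilities of
  substitution with evaluation used below.\<close>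

lemma (in coeff_hom) hom_eval_hom:
  assumes "\<And>c. \<phi> (\<psi> c) = \<psi>' c"
  shows "\<phi> (eval_hom \<psi> f p) = eval_hom \<psi>' (\<lambda>i. \<phi> (f i)) p"
  by (simp add: eval_hom_def monom_eval_def hom_sum hom_mult hom_prod hom_power assms)

lemma eval_hom_cong:
  assumes "\<And>i. i \<in> vars p \<Longrightarrow> f i = g i"
  shows "eval_hom \<phi> f p = eval_hom \<phi> g p"
  unfolding eval_hom_def monom_eval_def
proof (intro sum.cong refl arg_cong2[where f = "(*)"] prod.cong)
  fix m i assume "m \<in> keys p" "i \<in> keys m"
  then have "i \<in> vars p" by (auto simp: vars_def)
  then show "f i ^ lookup m i = g i ^ lookup m i" by (simp add: assms)
qed

lemma psubst_cong:
  assumes "\<And>i. i \<in> vars p \<Longrightarrow> f i = g i"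
  shows "psubst f p = psubst g p"
  unfolding psubst_def using assms by (rule eval_hom_cong)

lemma coeff_hom_pConst: "coeff_hom (\<lambda>c. [:c:] :: 'k::comm_ring_1 poly)"
  by unfold_locales (simp_all add: one_pCons)

lemma coeff_hom_eval_hom: "coeff_hom \<phi> \<Longrightarrow> coeff_hom (eval_hom \<phi> f)"
  by (simp add: coeff_hom_def coeff_hom.eval_hom_0 coeff_hom.eval_hom_1
      coeff_hom.eval_hom_add coeff_hom.eval_hom_mult)

lemma eval_hom_psubst:
  assumes "coeff_hom \<phi>"
  shows "eval_hom \<phi> f (psubst g p) = eval_hom \<phi> (\<lambda>i. eval_hom \<phi> f (g i)) p"
  unfolding psubst_def
  by (rule coeff_hom.hom_eval_hom[OF coeff_hom_eval_hom])
    (simp_all add: assms coeff_hom.eval_hom_Const)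

lemma lookup_Const_mult: "lookup (Const c * p) m = c * lookup p m"
proof -
  have "Const c * p = Poly_Mapping.map ((*) c) p"
    by (simp add: Const_def mult_map_scale_conv_mult)
  then show ?thesis
    by (simp add: map.rep_eq when_def)
qed

lemma Const_0 [simp]: "Const 0 = 0" and Const_1 [simp]: "Const 1 = 1"
  by (simp_all add: Const_def)

lemma Const_mult: "Const (a * b) = Const a * Const b"
  by (rule psubst.hom_mult)

lemma Const_uminus: "Const (- a) = - Const a"
  by (rule psubst.hom_uminus)

lemma lookup_Var: "lookup (Var i) m = (if m = single i 1 then 1 else 0)"
  by (simp add: Var_def lookup_single when_def)

lemma lookup_Const: "lookup (Const c) m = (if m = 0 then c else 0)"
  by (simp add: Const_def lookup_single when_def)

lemma monom_eval_Var: "monom_eval Var m = single m (1 :: 'k::comm_ring_1)"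
  using psubst_Var_id[of "single m (1::'k)"] by (simp add: psubst.eval_hom_single)

lemma Var_power: "(Var i :: ('v, 'k::comm_ring_1) mpoly) ^ k = single (single i k) 1"
  using monom_eval_Var[of "single i k"] by simp

lemma vars_1 [simp]: "vars 1 = {}" and vars_Const [simp]: "vars (Const c) = {}"
  by (auto simp: vars_def Const_def)

lemma vars_Var [simp]: "vars (Var i :: ('v, 'k::comm_ring_1) mpoly) = {i}"
  by (auto simp: vars_def Var_def)

lemma vars_add: "vars (p + q) \<subseteq> vars p \<union> vars q"
  using Poly_Mapping.keys_add[of p q] by (auto simp: vars_def)

lemma vars_uminus [simp]: "vars (- p :: ('v, 'k::comm_ring_1) mpoly) = vars p"
  by (simp add: vars_def)

lemma vars_sum: "vars (sum f A) \<subseteq> (\<Union>a\<in>A. vars (f a))"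
  using keys_sum[of f A] unfolding vars_def by fastforce

lemma vars_power: "vars (p ^ k) \<subseteq> vars (p :: ('v, 'k::comm_ring_1) mpoly)"
  by (induction k) (auto dest!: subsetD[OF vars_mult])

lemma vars_single: "vars (single m c) \<subseteq> keys m"
  by (auto simp: vars_def split: if_splits)

section \<open>Degree and order\<close>

lemma mdeg_UNIV: "mdeg (m :: 'n::finite \<Rightarrow>\<^sub>0 nat) = (\<Sum>i\<in>UNIV. lookup m i)"
  unfolding mdeg_def by (rule sum.mono_neutral_left) (auto simp: in_keys_iff)

lemma mdeg_add: "mdeg (m + m' :: 'n::finite \<Rightarrow>\<^sub>0 nat) = mdeg m + mdeg m'"
  by (simp add: mdeg_UNIV lookup_add sum.distrib)

lemma mdeg_0 [simp]: "mdeg 0 = 0"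
  by (simp add: mdeg_def)

lemma mdeg_single [simp]: "mdeg (single i k) = k"
  by (simp add: mdeg_def)

text \<open>Membership in the \<open>k\<close>-th power of the ideal generated by the variables, so
  that \<open>order_ge k (p - q)\<close> compares Taylor expansions at the origin. The zero
  polynomial has every order.\<close>

definition order_ge :: "nat \<Rightarrow> ('v, 'k::zero) mpoly \<Rightarrow> bool" where
  "order_ge k p \<longleftrightarrow> (\<forall>m\<in>keys p. k \<le> mdeg m)"

definition deg_le :: "nat \<Rightarrow> ('v, 'k::zero) mpoly \<Rightarrow> bool" where
  "deg_le k p \<longleftrightarrow> (\<forall>m\<in>keys p. mdeg m \<le> k)"

lemma order_ge_lookup: "order_ge k p \<Longrightarrow> mdeg m < k \<Longrightarrow> lookup p m = 0"
  by (metis order_ge_def in_keys_iff linorder_not_less)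

lemma order_ge_0 [simp]: "order_ge k 0" and order_ge_zero [simp]: "order_ge 0 p"
  by (simp_all add: order_ge_def)

lemma order_ge_mono: "order_ge k p \<Longrightarrow> l \<le> k \<Longrightarrow> order_ge l p"
  by (auto simp: order_ge_def)

lemma order_ge_add: "order_ge k p \<Longrightarrow> order_ge k q \<Longrightarrow> order_ge k (p + q)"
  using Poly_Mapping.keys_add[of p q] by (auto simp: order_ge_def)

lemma order_ge_uminus: "order_ge k p \<Longrightarrow> order_ge k (- p :: ('v, 'k::comm_ring_1) mpoly)"
  by (simp add: order_ge_def)

lemma order_ge_diff: "order_ge k p \<Longrightarrow> order_ge k q \<Longrightarrow> order_ge k (p - q :: ('v, 'k::comm_ring_1) mpoly)"
  using order_ge_add[of k p "- q"] by (simp add: order_ge_uminus)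

lemma order_ge_sum: "(\<And>a. a \<in> A \<Longrightarrow> order_ge k (f a)) \<Longrightarrow> order_ge k (sum f A)"
  by (induction A rule: infinite_finite_induct) (auto intro: order_ge_add)

lemma order_ge_mult:
  fixes p q :: "('n::finite, 'k::comm_ring_1) mpoly"
  assumes "order_ge a p" "order_ge b q"
  shows "order_ge (a + b) (p * q)"
  unfolding order_ge_def
proof
  fix m assume "m \<in> keys (p * q)"
  then obtain u v where "m = u + v" "u \<in> keys p" "v \<in> keys q"
    using Poly_Mapping.keys_mult[of p q] by blast
  then show "a + b \<le> mdeg m"
    using assms by (auto simp: order_ge_def mdeg_add intro: add_mono)
qed

lemma order_ge_power:
  fixes p :: "('n::finite, 'k::comm_ring_1) mpoly"
  shows "order_ge a p \<Longrightarrow> order_ge (k * a) (p ^ k)"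
  by (induction k) (auto intro: order_ge_mult)

lemma order_ge_Var: "order_ge 1 (Var i :: ('n::finite, 'k::comm_ring_1) mpoly)"
  by (simp add: order_ge_def Var_def)

lemma order_ge_Const_mult: "order_ge k p \<Longrightarrow> order_ge k (Const c * p :: ('v, 'k::comm_ring_1) mpoly)"
  by (auto simp: order_ge_def in_keys_iff lookup_Const_mult)

lemma order_ge_1_iff: "order_ge 1 p \<longleftrightarrow> lookup (p :: ('n::finite, 'k::zero) mpoly) 0 = 0"
proof
  assume "lookup p 0 = 0"
  moreover have "m = 0" if "mdeg m = 0" for m :: "'n \<Rightarrow>\<^sub>0 nat"
    using that by (intro poly_mapping_eqI) (simp add: mdeg_UNIV)
  ultimately show "order_ge 1 p"
    unfolding order_ge_def by (metis in_keys_iff less_one linorder_not_less)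
qed (simp add: order_ge_lookup)

lemma mdeg_eq_1D:
  fixes m :: "'n::finite \<Rightarrow>\<^sub>0 nat"
  assumes "mdeg m = 1"
  shows "\<exists>i. m = single i 1"
proof -
  obtain i where "lookup m i = 1" "\<forall>j\<noteq>i. lookup m j = 0"
    using assms sum_eq_1_iff[of UNIV "lookup m"] by (auto simp: mdeg_UNIV)
  then have "m = single i 1"
    by (intro poly_mapping_eqI) (auto simp: lookup_single when_def)
  then show ?thesis ..
qed

text \<open>Follows from \<open>p * q - p' * q' = (p - p') * q + p' * (q - q')\<close>: leading
  parts multiply.\<close>

lemma mult_congruence:
  fixes p q :: "('n::finite, 'k::comm_ring_1) mpoly"
  assumes "order_ge (Suc a) (p - p')" "order_ge (Suc b) (q - q')" "order_ge a p'" "order_ge b q'"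
  shows "order_ge (Suc (a + b)) (p * q - p' * q')" "order_ge (a + b) (p' * q')"
proof -
  \<comment> \<open>\<open>q\<close> inherits order \<open>b\<close> from \<open>q'\<close>, because
    \<open>q - q'\<close> has even higher order.\<close>
  have "order_ge (b) ((q - q') + q')"
    using assms by (intro order_ge_add) (auto intro: order_ge_mono)
  then have "order_ge (Suc a + b) ((p - p') * q)" "order_ge (a + Suc b) (p' * (q - q'))"
    using assms by (auto intro!: order_ge_mult simp del: add_Suc add_Suc_right)
  then have "order_ge (Suc (a + b)) ((p - p') * q + p' * (q - q'))"
    by (intro order_ge_add) auto
  then show "order_ge (Suc (a + b)) (p * q - p' * q')"
    by (simp add: algebra_simps)
  show "order_ge (a + b) (p' * q')"
    using assms by (intro order_ge_mult)
qed

text \<open>First powers of one variable, then products of such powers are compared by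
  \<open>mult_congruence\<close>: a substitution tangent to the identity alters a monomial only in
  degrees above its own.\<close>

lemma monom_eval_congruence:
  fixes f :: "'n::finite \<Rightarrow> ('n, 'k::comm_ring_1) mpoly"
  assumes "\<And>i. order_ge 2 (f i - Var i)"
  shows "order_ge (Suc (mdeg m)) (monom_eval f m - monom_eval Var m)"
proof -
  have pow: "order_ge (Suc k) (f i ^ k - Var i ^ k) \<and> order_ge k (Var i ^ k :: ('n, 'k) mpoly)"
    for i k
  proof (induction k)
    case (Suc k)
    then show ?case
      using mult_congruence[of 1 "f i" "Var i" k "f i ^ k" "Var i ^ k"] assms[of i] order_ge_Var[where ?'k = 'k and i = i]
      by (simp add: numeral_2_eq_2)
  qed simp
  have "order_ge (Suc (\<Sum>i\<in>A. lookup m i)) ((\<Prod>i\<in>A. f i ^ lookup m i) - (\<Prod>i\<in>A. Var i ^ lookup m i))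
      \<and> order_ge (\<Sum>i\<in>A. lookup m i) (\<Prod>i\<in>A. Var i ^ lookup m i :: ('n, 'k) mpoly)"
    if "finite A" for A
    using that
  proof (induction A)
    case (insert i A)
    then show ?case
      using mult_congruence[OF pow[THEN conjunct1] _ pow[THEN conjunct2], of "sum (lookup m) A"]
      by auto
  qed simp
  then show ?thesis
    by (simp add: monom_eval_def mdeg_def)
qed

lemma order_ge_psubst:
  fixes f :: "'n::finite \<Rightarrow> ('n, 'k::comm_ring_1) mpoly"
  assumes "order_ge k p" "\<And>i. order_ge 1 (f i)"
  shows "order_ge k (psubst f p)"
proof -
  have "order_ge (mdeg m) (monom_eval f m)" for m
  proof -
    have "order_ge (\<Sum>i\<in>A. lookup m i) (\<Prod>i\<in>A. f i ^ lookup m i)" if "finite A" for A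
      using that
    proof (induction A)
      case (insert i A)
      then show ?case
        using order_ge_mult[OF order_ge_power[OF assms(2), of "lookup m i" i]] by simp
    qed simp
    then show ?thesis by (simp add: monom_eval_def mdeg_def)
  qed
  then show ?thesis
    using assms(1) unfolding psubst_def eval_hom_def order_ge_def[of k p]
    by (intro order_ge_sum order_ge_Const_mult) (blast intro: order_ge_mono)
qed

text \<open>By linearity the claim reduces to monomials. It says that a substitution tangent to the
  identity preserves the lowest-degree part of a polynomial.\<close>

lemma order_ge_psubst_diff:
  fixes f :: "'n::finite \<Rightarrow> ('n, 'k::comm_ring_1) mpoly"
  assumes "order_ge k p" "\<And>i. order_ge 2 (f i - Var i)"
  shows "order_ge (Suc k) (psubst f p - p)"
proof -
  have "psubst f p - psubst Var p =
      (\<Sum>m\<in>keys p. Const (lookup p m) * (monom_eval f m - monom_eval Var m))"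
    by (simp add: psubst_def eval_hom_def sum_subtractf right_diff_distrib)
  also have "order_ge (Suc k) \<dots>"
    using assms(1) monom_eval_congruence[OF assms(2)] unfolding order_ge_def[of k p]
    by (intro order_ge_sum order_ge_Const_mult) (blast intro: order_ge_mono)
  finally show ?thesis by (simp add: psubst_Var_id)
qed

section \<open>Bounds on the degree\<close>

lemma deg_le_add: "deg_le k p \<Longrightarrow> deg_le k q \<Longrightarrow> deg_le k (p + q)"
  using Poly_Mapping.keys_add[of p q] by (auto simp: deg_le_def)

lemma deg_le_sum: "(\<And>a. a \<in> A \<Longrightarrow> deg_le k (f a)) \<Longrightarrow> deg_le k (sum f A)"
  by (induction A rule: infinite_finite_induct) (auto intro: deg_le_add simp: deg_le_def[of _ 0])

lemma deg_le_Const_mult: "deg_le k p \<Longrightarrow> deg_le k (Const c * p :: ('v, 'k::comm_ring_1) mpoly)"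
  by (auto simp: deg_le_def in_keys_iff lookup_Const_mult)

lemma deg_le_Const: "deg_le k (Const c)" and deg_le_Var: "deg_le 1 (Var i)"
  by (auto simp: deg_le_def Const_def Var_def split: if_splits)

lemma deg_le_uminus: "deg_le k p \<Longrightarrow> deg_le k (- p :: ('v, 'k::comm_ring_1) mpoly)"
  by (simp add: deg_le_def)

lemma deg_le_diff: "deg_le k p \<Longrightarrow> deg_le k q \<Longrightarrow> deg_le k (p - q :: ('v, 'k::comm_ring_1) mpoly)"
  using deg_le_add[of k p "- q"] by (simp add: deg_le_uminus)

lemmas deg_le_intros = deg_le_add deg_le_sum deg_le_Const_mult deg_le_Const deg_le_Var
  deg_le_uminus deg_le_diff

lemma total_deg_le_iff: "total_deg p \<le> k \<longleftrightarrow> deg_le k p"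
  by (auto simp: total_deg_def deg_le_def)

lemma endo_deg_le_iff: "endo_deg \<sigma> \<le> k \<longleftrightarrow> (\<forall>i. deg_le k (\<sigma> i))"
  by (auto simp: endo_deg_def total_deg_le_iff)

section \<open>The group of automorphisms\<close>

definition comp :: "('n::finite, 'k::field) endo \<Rightarrow> ('n, 'k) endo \<Rightarrow> ('n, 'k) endo"  (infixl "\<bullet>" 70) where
  "\<sigma> \<bullet> \<tau> = (\<lambda>i. psubst \<tau> (\<sigma> i))"

lemmas psubst_simps = psubst.eval_hom_add psubst.eval_hom_diff psubst.eval_hom_uminus
  psubst.eval_hom_mult psubst.eval_hom_power psubst.eval_hom_sum psubst.eval_hom_Const
  psubst.eval_hom_0 psubst.eval_hom_1 psubst_Var

lemma comp_assoc: "\<rho> \<bullet> \<sigma> \<bullet> \<tau> = \<rho> \<bullet> (\<sigma> \<bullet> \<tau>)"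
  by (simp add: comp_def psubst_psubst)

lemma comp_Var [simp]: "\<sigma> \<bullet> Var = \<sigma>" "Var \<bullet> \<sigma> = \<sigma>"
  by (simp_all add: comp_def psubst_Var psubst_Var_id)

lemma mult_GA: "\<sigma> \<otimes>\<^bsub>GA\<^esub> \<tau> = \<sigma> \<bullet> \<tau>"
  by (simp add: GA_def units_of_def End_monoid_def comp_def)

lemma one_GA: "\<one>\<^bsub>GA\<^esub> = Var"
  by (simp add: GA_def units_of_def End_monoid_def)

lemma carrier_GA: "carrier GA = {\<sigma>. \<exists>\<tau>. \<sigma> \<bullet> \<tau> = Var \<and> \<tau> \<bullet> \<sigma> = Var}"
  by (auto simp: GA_def units_of_def End_monoid_def comp_def Units_def)

lemma carrier_GAI: "\<sigma> \<bullet> \<tau> = Var \<Longrightarrow> \<tau> \<bullet> \<sigma> = Var \<Longrightarrow> \<sigma> \<in> carrier GA"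
  by (auto simp: carrier_GA)

lemma inv_GA_eq:
  assumes "\<sigma> \<bullet> \<tau> = Var" "\<tau> \<bullet> \<sigma> = Var"
  shows "inv\<^bsub>GA\<^esub> \<sigma> = \<tau>"
  by (rule group.inv_equality[OF group_GA]) (use assms in \<open>auto simp: carrier_GA mult_GA one_GA\<close>)

text \<open>A tuple of constants is not invertible, because substituting into a constant never
  yields a variable. As \<open>Aff\<close> asks for degree exactly 1, this spares
  \<open>AffI\<close> the lower bound.\<close>

lemma endo_deg_pos:
  assumes "(\<sigma> :: ('n::finite, 'k::field) endo) \<in> carrier GA"
  shows "endo_deg \<sigma> \<ge> 1"
proof (rule ccontr)
  assume "\<not> endo_deg \<sigma> \<ge> 1"
  then have deg: "deg_le 0 (\<sigma> i)" for i
    using endo_deg_le_iff[of \<sigma> 0] by simp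
  have const: "\<sigma> i = Const (lookup (\<sigma> i) 0)" for i
  proof (rule poly_mapping_eqI)
    fix m :: "'n \<Rightarrow>\<^sub>0 nat"
    have "m = 0 \<or> lookup (\<sigma> i) m = 0"
    proof (cases "mdeg m = 0")
      case True
      then show ?thesis by (auto simp: mdeg_UNIV intro: poly_mapping_eqI)
    next
      case False
      then show ?thesis using deg[of i] by (auto simp: deg_le_def in_keys_iff)
    qed
    then show "lookup (\<sigma> i) m = lookup (Const (lookup (\<sigma> i) 0)) m"
      by (auto simp: lookup_Const)
  qed
  obtain \<tau> where "\<sigma> \<bullet> \<tau> = Var"
    using assms by (auto simp: carrier_GA)
  then have "(Var i :: ('n, 'k) mpoly) = psubst \<tau> (\<sigma> i)" for i
    by (metis comp_def)
  then have "(Var i :: ('n, 'k) mpoly) = Const (lookup (\<sigma> i) 0)" for i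
    by (metis const psubst.eval_hom_Const)
  then have "vars (Var undefined :: ('n, 'k) mpoly) = {}"
    by (metis vars_Const)
  then show False by simp
qed

lemma AffI:
  assumes "\<And>i. deg_le 1 (\<sigma> i)" "\<sigma> \<bullet> \<tau> = Var" "\<tau> \<bullet> \<sigma> = Var"
  shows "\<sigma> \<in> Aff"
  unfolding Aff_def
  using endo_deg_pos[of \<sigma>] endo_deg_le_iff[of \<sigma> 1] carrier_GAI[OF assms(2,3)] assms(1)
  by (simp add: order_antisym)

section \<open>Elementary, diagonal and other affine automorphisms\<close>

definition elementary :: "'n \<Rightarrow> ('n, 'k) mpoly \<Rightarrow> ('n::finite, 'k::field) endo" where
  "elementary i p = Var(i := Var i + p)"

lemma psubst_elementary:
  assumes "i \<notin> vars p"
  shows "psubst (elementary i q) p = p"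
proof -
  have "psubst (elementary i q) p = psubst Var p"
    using assms by (intro psubst_cong) (auto simp: elementary_def)
  then show ?thesis by (simp add: psubst_Var_id)
qed

lemma elementary_0 [simp]: "elementary i 0 = Var"
  by (simp add: elementary_def)

lemma elementary_comp:
  assumes "i \<notin> vars p"
  shows "elementary i p \<bullet> elementary i q = elementary i (p + q)"
proof
  fix l
  show "(elementary i p \<bullet> elementary i q) l = elementary i (p + q) l"
    using psubst_elementary[OF assms, of q]
    by (simp add: comp_def elementary_def[of i p] psubst_simps) (simp add: elementary_def)
qed

lemma elementary_inverse:
  assumes "i \<notin> vars p"
  shows "elementary i p \<bullet> elementary i (- p) = Var" "elementary i (- p) \<bullet> elementary i p = Var"
  using assms by (simp_all add: elementary_comp)

lemma elementary_in_GA: "i \<notin> vars p \<Longrightarrow> elementary i p \<in> carrier GA"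
  by (rule carrier_GAI[OF elementary_inverse])

lemma elementary_in_Aff: "i \<notin> vars p \<Longrightarrow> deg_le 1 p \<Longrightarrow> elementary i p \<in> Aff"
  by (rule AffI[OF _ elementary_inverse]) (auto simp: elementary_def intro!: deg_le_intros simp del: One_nat_def)

definition dilation :: "('n \<Rightarrow> 'k) \<Rightarrow> ('n::finite, 'k::field) endo" where
  "dilation b = (\<lambda>i. Const (b i) * Var i)"

lemma dilation_comp: "dilation b \<bullet> dilation c = dilation (\<lambda>i. b i * c i)"
  by (simp add: dilation_def comp_def psubst.eval_hom_mult psubst.eval_hom_Const psubst_Var
      Const_mult mult_ac)

lemma dilation_comp_left: "dilation b \<bullet> \<sigma> = (\<lambda>i. Const (b i) * \<sigma> i)"
  by (simp add: dilation_def comp_def psubst_simps)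

lemma dilation_inverse:
  assumes "\<And>i. b i \<noteq> 0"
  shows "dilation b \<bullet> dilation (\<lambda>i. inverse (b i)) = Var"
    "dilation (\<lambda>i. inverse (b i)) \<bullet> dilation b = Var"
  using assms by (simp_all add: dilation_comp, simp_all add: dilation_def)

lemma dilation_in_Aff: "(\<And>i. b i \<noteq> 0) \<Longrightarrow> dilation b \<in> Aff"
  by (rule AffI[OF _ dilation_inverse]) (auto simp: dilation_def intro!: deg_le_intros simp del: One_nat_def)

text \<open>Monomials are common eigenvectors of the diagonal substitutions. Both the degenerations
  and the isolation of single monomials rest on these eigenvalues.\<close>

lemma lookup_psubst_dilation:
  "lookup (psubst (dilation b) p) m = (\<Prod>i\<in>UNIV. b i ^ lookup m i) * lookup p m"
proof -
  have M: "monom_eval (dilation b) m = single m (\<Prod>i\<in>UNIV. b i ^ lookup m i)" for m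
  proof -
    have "monom_eval (dilation b) m = Const (\<Prod>i\<in>UNIV. b i ^ lookup m i) * monom_eval Var m"
      by (simp add: monom_eval_superset[of UNIV] dilation_def power_mult_distrib prod.distrib
          psubst.hom_prod psubst.hom_power)
    then show ?thesis by (simp add: monom_eval_Var Const_def mult_single)
  qed
  have "lookup (psubst (dilation b) p) m =
      (\<Sum>m'\<in>keys p. lookup p m' * (if m = m' then \<Prod>i\<in>UNIV. b i ^ lookup m' i else 0))"
    unfolding psubst_def eval_hom_def lookup_sum lookup_Const_mult M
    by (auto simp: lookup_single when_def intro!: sum.cong)
  also have "\<dots> = (\<Sum>m'\<in>keys p. if m = m' then lookup p m * (\<Prod>i\<in>UNIV. b i ^ lookup m i) else 0)"
    by (intro sum.cong) auto
  also have "\<dots> = (\<Prod>i\<in>UNIV. b i ^ lookup m i) * lookup p m"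
    by (simp add: in_keys_iff)
  finally show ?thesis .
qed

lemma translation_in_Aff: "(\<lambda>i. Var i + Const (b i)) \<in> Aff"
  by (rule AffI[where \<tau> = "\<lambda>i. Var i + Const (- b i)"])
    (auto simp: comp_def psubst_simps Const_uminus intro!: deg_le_intros simp del: One_nat_def)

lemma permutation_in_Aff: "f \<circ> f = id \<Longrightarrow> (\<lambda>i. Var (f i)) \<in> Aff"
  by (rule AffI[where \<tau> = "\<lambda>i. Var (f i)"])
    (auto simp: comp_def psubst_Var fun_eq_iff intro!: deg_le_intros simp del: One_nat_def)

section \<open>Degenerations\<close>

text \<open>Multiplying by the variable removes the exceptional point, and a polynomial vanishing on
  a whole infinite field is zero.\<close>

lemma poly_zero_if_off_0:
  fixes p :: "'k::field_char_0 poly"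
  assumes "\<And>t. t \<noteq> 0 \<Longrightarrow> poly p t = 0"
  shows "p = 0"
proof -
  have "poly ([:0, 1:] * p) = poly 0"
    using assms by (auto simp: fun_eq_iff)
  then show ?thesis
    unfolding poly_eq_poly_eq_iff by simp
qed

text \<open>Pulled back along the curve \<open>t \<mapsto> F t\<close>, each equation of a closed
  set cutting out \<open>H\<close> becomes a polynomial in \<open>t\<close> that vanishes off 0,
  hence also at 0.\<close>

lemma closed_limit:
  fixes F :: "'k::field_char_0 \<Rightarrow> ('n::finite, 'k) endo"
  assumes closed: "closedin (subtopology End_topology (carrier GA)) H"
    and F: "\<And>t. t \<noteq> 0 \<Longrightarrow> F t \<in> H" and F0: "F 0 \<in> carrier GA"
    and deg: "\<And>t. endo_deg (F t) \<le> d"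
    and coeffs: "\<And>i m t. lookup (F t i) m = poly (c i m) t"
  shows "F 0 \<in> H"
proof -
  obtain C where C: "closedin End_topology C" "H = carrier GA \<inter> C"
    using closed by (auto simp: closedin_subtopology)
  \<comment> \<open>The limit topology tests closedness only on \<open>End_le d\<close> with
    \<open>d \<ge> 1\<close>.\<close>
  define e where "e = max d 1"
  have "zariski_closed e (C \<inter> End_le e)"
    using C(1) unfolding closedin_End_topology closedin_zariski e_def by simp
  then obtain S where S: "C \<inter> End_le e = zero_locus e S"
    by (auto simp: zariski_closed_def)
  have End_le: "F t \<in> End_le e" for t
    using deg[of t] by (simp add: End_le_def e_def)
  have "peval (coords (F 0)) P = 0" if "P \<in> S" for P
  proof -
    have F_poly: "coords (F t) = (\<lambda>x. poly (case x of (i, m) \<Rightarrow> c i m) t)" for t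
      by (auto simp: coords_def coeffs)
    have poly_t: "coeff_hom (\<lambda>q. poly q t)" for t :: 'k
      by unfold_locales auto
    \<comment> \<open>\<open>q\<close> is the equation \<open>P\<close> with the coefficient
      polynomials \<open>c i m\<close> substituted for its coordinates.\<close>
    define q where "q = eval_hom (\<lambda>c. [:c:]) (\<lambda>(i, m). c i m) P"
    have q: "poly q t = peval (coords (F t)) P" for t
      unfolding q_def peval_def F_poly
      by (subst coeff_hom.hom_eval_hom[OF poly_t]) (auto simp: case_prod_beta)
    have "poly q t = 0" if "t \<noteq> 0" for t
    proof -
      have "F t \<in> zero_locus e S"
        using F[OF that] C(2) End_le S by blast
      then show ?thesis
        using \<open>P \<in> S\<close> by (simp add: q zero_locus_def)
    qed
    then have "q = 0" by (rule poly_zero_if_off_0)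
    then show ?thesis using q[of 0] by simp
  qed
  then have "F 0 \<in> C"
    using S End_le[of 0] by (auto simp: zero_locus_def)
  then show ?thesis using C(2) F0 by simp
qed

section \<open>Weighted degenerations inside a closed subgroup\<close>

text \<open>The exponent of \<open>t\<close> that the monomial \<open>m\<close> acquires when each
  variable \<open>i\<close> is scaled by \<open>t ^ a i\<close>.\<close>

definition wdeg :: "('n::finite \<Rightarrow> nat) \<Rightarrow> ('n \<Rightarrow>\<^sub>0 nat) \<Rightarrow> nat" where
  "wdeg a m = (\<Sum>i\<in>UNIV. a i * lookup m i)"

text \<open>Strictness of the inclusion enters later, through the element outside \<open>Aff\<close>
  given to \<open>quadratic_shear_exists\<close>.\<close>

locale closed_subgroup_above_Aff =
  fixes H :: "('n::finite, 'k::field_char_0) endo set"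
  assumes subgroup: "subgroup H GA"
    and closed: "closedin (subtopology End_topology (carrier GA)) H"
    and Aff_subset: "Aff \<subseteq> H"
begin

lemma comp_in_H: "\<sigma> \<in> H \<Longrightarrow> \<tau> \<in> H \<Longrightarrow> \<sigma> \<bullet> \<tau> \<in> H"
  using subgroup.m_closed[OF subgroup] by (simp add: mult_GA)

lemma Var_in_H: "Var \<in> H"
  using subgroup.one_closed[OF subgroup] by (simp add: one_GA)

lemma in_GA: "\<sigma> \<in> H \<Longrightarrow> \<sigma> \<in> carrier GA"
  using subgroup.subset[OF subgroup] by blast

lemma inverse_in_H: "\<sigma> \<in> H \<Longrightarrow> \<sigma> \<bullet> \<tau> = Var \<Longrightarrow> \<tau> \<bullet> \<sigma> = Var \<Longrightarrow> \<tau> \<in> H"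
  using subgroup.m_inv_closed[OF subgroup, of \<sigma>] by (simp add: inv_GA_eq)

text \<open>
  The part of weight \<open>0\<close> is the limit for \<open>t \<longrightarrow> 0\<close> of the conjugates of \<open>h\<close> by \<open>diag (t ^ a)\<close>.
\<close>

lemma degeneration:
  assumes h: "h \<in> H"
    and weights: "\<And>i m. m \<in> keys (h i) \<Longrightarrow> a i \<le> wdeg a m"
    and h0: "h0 \<in> carrier GA"
      "\<And>i m. lookup (h0 i) m = (if wdeg a m = a i then lookup (h i) m else 0)"
  shows "h0 \<in> H"
proof -
  \<comment> \<open>For \<open>t \<noteq> 0\<close> this is the conjugate of \<open>h\<close>,
    written coefficientwise. The formula also makes sense at \<open>t = 0\<close>, since
    \<open>weights\<close> keeps the natural subtraction from truncating on the support of
    \<open>h i\<close>.\<close>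
  define F where
    "F t i = Poly_Mapping.mapp (\<lambda>m c. c * t ^ (wdeg a m - a i)) (h i)" for t :: 'k and i
  have lookup_F: "lookup (F t i) m = lookup (h i) m * t ^ (wdeg a m - a i)" for t i m
    by (simp add: F_def lookup_mapp when_def in_keys_iff)
  have F0: "F 0 = h0"
  proof (intro ext poly_mapping_eqI)
    fix i m
    show "lookup (F 0 i) m = lookup (h0 i) m"
      \<comment> \<open>At \<open>t = 0\<close> exactly the terms with exponent 0 survive, as
        \<open>0 ^ 0 = 1\<close>.\<close>
      using weights[of m i] by (cases "lookup (h i) m = 0") (auto simp: lookup_F h0(2) in_keys_iff power_0_left)
  qed
  have "F t \<in> H" if "t \<noteq> 0" for t
  proof -
    define b where "b = (\<lambda>i. t ^ a i)"
    have "F t = dilation (\<lambda>i. inverse (b i)) \<bullet> (h \<bullet> dilation b)"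
    proof (intro ext poly_mapping_eqI)
      fix i m
      have "(\<Prod>j\<in>UNIV. b j ^ lookup m j) = t ^ wdeg a m"
        by (simp add: b_def wdeg_def power_sum power_mult)
      then have "lookup ((dilation (\<lambda>i. inverse (b i)) \<bullet> (h \<bullet> dilation b)) i) m =
          inverse (t ^ a i) * (t ^ wdeg a m * lookup (h i) m)"
        unfolding dilation_comp_left
        by (simp add: comp_def lookup_Const_mult lookup_psubst_dilation) (simp add: b_def)
      also have "\<dots> = lookup (F t i) m"
        using that weights[of m i]
        by (cases "lookup (h i) m = 0") (auto simp: lookup_F in_keys_iff power_diff field_simps)
      finally show "lookup (F t i) m =
          lookup ((dilation (\<lambda>i. inverse (b i)) \<bullet> (h \<bullet> dilation b)) i) m" by simp
    qed
    moreover have "dilation b \<in> H" "dilation (\<lambda>i. inverse (b i)) \<in> H"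
      using that Aff_subset by (auto simp: b_def intro!: dilation_in_Aff)
    ultimately show ?thesis using h by (simp add: comp_in_H)
  qed
  moreover have "deg_le (endo_deg h) (F t i)" for t i
    using order_refl[of "endo_deg h"] keys_mapp_subset[of _ "h i"]
    unfolding endo_deg_le_iff F_def deg_le_def by blast
  then have "endo_deg (F t) \<le> endo_deg h" for t
    by (simp add: endo_deg_le_iff)
  moreover have "lookup (F t i) m = poly (monom (lookup (h i) m) (wdeg a m - a i)) t" for t i m
    by (simp add: lookup_F poly_monom)
  ultimately have "F 0 \<in> H"
    using h0(1)
    by - (rule closed_limit[OF closed, of F "endo_deg h"
          "\<lambda>i m. monom (lookup (h i) m) (wdeg a m - a i)"], simp_all add: F0)
  then show ?thesis by (simp only: F0)
qed

text \<open>Conjugation by the dilation that scales only \<open>x\<^sub>i\<close> by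
  \<open>c\<close> multiplies \<open>p\<close>, which is free of that variable, by \<open>c\<close>.
  For \<open>c = 0\<close> the result is the identity.\<close>

lemma elementary_scale:
  assumes "elementary i p \<in> H" "i \<notin> vars p"
  shows "elementary i (Const c * p) \<in> H"
proof (cases "c = 0")
  case False
  define b where "b = (\<lambda>l. if l = i then c else 1)"
  have b: "b l \<noteq> 0" for l using False by (simp add: b_def)
  have "psubst (dilation (\<lambda>l. inverse (b l))) p = psubst Var p"
    using assms(2) by (intro psubst_cong) (auto simp: dilation_def b_def)
  then have *: "(elementary i p \<bullet> dilation (\<lambda>l. inverse (b l))) l =
      dilation (\<lambda>l. inverse (b l)) l + (if l = i then p else 0)" for l
    by (simp add: comp_def elementary_def psubst_simps psubst_Var_id)
  have "dilation b \<bullet> (elementary i p \<bullet> dilation (\<lambda>l. inverse (b l))) = elementary i (Const c * p)"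
    using False unfolding dilation_comp_left *
    by (auto simp: dilation_def b_def elementary_def distrib_left simp flip: Const_mult mult.assoc)
  moreover have "dilation b \<in> H" "dilation (\<lambda>i. inverse (b i)) \<in> H"
    using b Aff_subset by (auto intro!: dilation_in_Aff)
  ultimately show ?thesis using assms(1) by (metis comp_in_H)
qed (simp add: Var_in_H)

end

section \<open>Restriction to a coordinate axis\<close>

interpretation pconst: coeff_hom "\<lambda>c. [:c:] :: 'k::comm_ring_1 poly"
  by (rule coeff_hom_pConst)

definition line :: "'n \<Rightarrow> ('n, 'k::comm_ring_1) mpoly \<Rightarrow> 'k poly" where
  "line j = eval_hom (\<lambda>c. [:c:]) (\<lambda>l. if l = j then [:0, 1:] else 0)"

lemmas line_simps = pconst.eval_hom_add[of "\<lambda>l. if l = j then [:0, 1:] else 0" for j, folded line_def]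
  pconst.eval_hom_diff[of "\<lambda>l. if l = j then [:0, 1:] else 0" for j, folded line_def]
  pconst.eval_hom_mult[of "\<lambda>l. if l = j then [:0, 1:] else 0" for j, folded line_def]
  pconst.eval_hom_power[of "\<lambda>l. if l = j then [:0, 1:] else 0" for j, folded line_def]
  pconst.eval_hom_Var[of "\<lambda>l. if l = j then [:0, 1:] else 0" for j, folded line_def]
  pconst.eval_hom_Const[of "\<lambda>l. if l = j then [:0, 1:] else 0" for j, folded line_def]

lemma coeff_line:
  fixes p :: "('n, 'k::comm_ring_1) mpoly"
  shows "coeff (line j p) k = lookup p (single j k)"
proof -
  let ?f = "\<lambda>l. if l = j then [:0, 1:] else 0 :: 'k poly"
  have "coeff (monom_eval ?f m) k = (if m = single j k then 1 else 0)" for m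
  proof (cases "keys m \<subseteq> {j}")
    case True
    then have "m = single j (lookup m j)"
      by (intro poly_mapping_eqI) (auto simp: lookup_single when_def in_keys_iff subset_iff)
    then obtain e where e: "m = single j e" by blast
    have "[:0, 1:] ^ e = (monom 1 e :: 'k poly)"
      by (simp add: monom_altdef)
    then show ?thesis
      unfolding e by (auto simp: inj_eq[OF inj_single] dest!: arg_cong[where f = "\<lambda>m. lookup m j"])
  next
    case False
    then obtain l where "l \<in> keys m" "l \<noteq> j" by blast
    then have "monom_eval ?f m = 0"
      unfolding monom_eval_def by (intro prod_zero) (auto simp: in_keys_iff power_0_left)
    moreover have "m \<noteq> single j k"
      using False by (auto split: if_splits)
    ultimately show ?thesis by simp
  qed
  then have "coeff (line j p) k = (\<Sum>m\<in>keys p. lookup p m * (if m = single j k then 1 else 0))"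
    by (simp add: line_def eval_hom_def coeff_sum)
  also have "\<dots> = (\<Sum>m\<in>keys p. if m = single j k then lookup p (single j k) else 0)"
    by (intro sum.cong) auto
  also have "\<dots> = lookup p (single j k)"
    by (simp add: in_keys_iff)
  finally show ?thesis .
qed

section \<open>Shears by powers of a coordinate\<close>

lemma wdeg_single: "wdeg a (single l e) = a l * e"
proof -
  have "wdeg a (single l e) = (\<Sum>i\<in>UNIV. if i = l then a l * e else 0)"
    unfolding wdeg_def by (intro sum.cong) (auto simp: lookup_single when_def)
  then show ?thesis by simp
qed

lemma wdeg_ge:
  assumes "\<And>i. w \<le> a i"
  shows "w * mdeg m \<le> wdeg a m"
  unfolding wdeg_def mdeg_UNIV sum_distrib_left by (intro sum_mono mult_right_mono) (auto simp: assms)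

text \<open>A monomial that is not a power of \<open>x\<^sub>j\<close> contains another variable,
  whose weight exceeds \<open>w\<close>.\<close>

lemma wdeg_gt:
  assumes "\<And>i. w \<le> a i" "\<And>i. i \<noteq> j \<Longrightarrow> w < a i" "m \<noteq> single j (mdeg m)"
  shows "w * mdeg m < wdeg a m"
proof -
  have "\<exists>l. l \<noteq> j \<and> lookup m l \<noteq> 0"
  proof (rule ccontr)
    assume *: "\<not> ?thesis"
    then have "m = single j (lookup m j)"
      by (intro poly_mapping_eqI) (auto simp: lookup_single when_def)
    then show False using assms(3) by (metis mdeg_single)
  qed
  then obtain l where l: "l \<noteq> j" "lookup m l \<noteq> 0" by blast
  show ?thesis
    unfolding wdeg_def mdeg_UNIV sum_distrib_left
  proof (rule sum_strict_mono_ex1)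
    show "\<exists>i\<in>UNIV. w * lookup m i < a i * lookup m i"
      using l assms(2)[of l] by (intro bexI[of _ l]) auto
  qed (auto simp: assms)
qed

lemma order_ge_1_of_diff:
  fixes p :: "('n::finite, 'k::comm_ring_1) mpoly"
  assumes "order_ge 2 (p - Var i)"
  shows "order_ge 1 p"
proof -
  have "order_ge 1 (p - Var i + Var i)"
    using assms order_ge_Var by (intro order_ge_add) (auto intro: order_ge_mono)
  then show ?thesis by simp
qed

text \<open>Uses \<open>f \<bullet> g - id = (f - id) \<bullet> g + (g - id)\<close>, where
  \<open>g\<close> fixes the origin.\<close>

lemma order_ge_comp_diff:
  assumes "\<And>l. order_ge 2 (f l - Var l)" "\<And>l. order_ge 2 (g l - Var l)"
  shows "order_ge 2 ((f \<bullet> g) l - Var l)"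
proof -
  have "order_ge 1 (g i)" for i
    using assms(2) by (rule order_ge_1_of_diff)
  then have "order_ge 2 (psubst g (f l - Var l) + (g l - Var l))"
    by (intro order_ge_add order_ge_psubst assms)
  then show ?thesis by (simp add: comp_def psubst_simps)
qed

lemma vars_Var_power: "vars ((Var j :: ('v, 'k::comm_ring_1) mpoly) ^ k) \<subseteq> {j}"
  using vars_power[of "Var j" k] by simp

lemma coeff_one_minus_power: "coeff ([:1, -1:] ^ k) 1 = (- of_nat k :: 'k::comm_ring_1)"
proof -
  have "coeff ([:1, -1:] ^ k) 0 = (1 :: 'k)"
    by (induction k) simp_all
  then show ?thesis
    by (induction k) (simp_all add: coeff_pCons)
qed

context closed_subgroup_above_Aff
begin

text \<open>The weights kill everything beyond the identity except the power of \<open>x\<^sub>j\<close> in the component \<open>i\<close>.\<close>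

lemma power_shear:
  assumes h: "h \<in> H" "\<And>l. order_ge k (h l - Var l)" and "k \<ge> 2" "i \<noteq> j"
  shows "elementary i (Const (lookup (h i) (single j k)) * Var j ^ k) \<in> H"
proof (rule degeneration)
  \<comment> \<open>Only \<open>x\<^sub>j\<close> has the minimal weight 2, so a monomial of degree
    at least \<open>k\<close> has weight at least \<open>2 * k\<close>, with equality only for
    \<open>x\<^sub>j ^ k\<close>. Component \<open>i\<close> has weight \<open>2 * k\<close>; all
    others have weight at most 3, below \<open>2 * k\<close> because
    \<open>k \<ge> 2\<close>.\<close>
  let ?a = "\<lambda>l. if l = j then 2 else if l = i then 2 * k else (3::nat)"
  have low: "lookup (h l) m = (if m = single l 1 then 1 else 0)" if "mdeg m < k" for l m
    using order_ge_lookup[OF h(2) that, of l] by (simp add: lookup_minus lookup_Var)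
  have high: "2 * k \<le> wdeg ?a m" if "k \<le> mdeg m" for m
  proof -
    have "2 * mdeg m \<le> wdeg ?a m"
      using \<open>k \<ge> 2\<close> by (intro wdeg_ge) auto
    then show ?thesis using that by linarith
  qed
  have higher: "2 * k < wdeg ?a m" if "k \<le> mdeg m" "m \<noteq> single j k" for m
  proof (cases "m = single j (mdeg m)")
    case True
    then have "k < mdeg m" using that by (metis le_neq_implies_less)
    then show ?thesis using True wdeg_single[of ?a j "mdeg m"] by simp
  next
    case False
    then have "2 * mdeg m < wdeg ?a m"
      using \<open>k \<ge> 2\<close> by (intro wdeg_gt) auto
    then show ?thesis using that by simp
  qed
  show "h \<in> H" by fact
  show "elementary i (Const (lookup (h i) (single j k)) * Var j ^ k) \<in> carrier GA"
    using \<open>i \<noteq> j\<close> vars_mult[of "Const (lookup (h i) (single j k))" "Var j ^ k"] vars_Var_power[of j k]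
    by (intro elementary_in_GA) auto
  show "?a l \<le> wdeg ?a m" if m: "m \<in> keys (h l)" for l m
  proof (cases "mdeg m < k")
    case True
    then have "m = single l 1" using low[OF True, of l] m by (auto simp: in_keys_iff split: if_splits)
    then show ?thesis using wdeg_single[of ?a l 1] by simp
  next
    case False
    then have "2 * k \<le> wdeg ?a m" by (simp add: high)
    then show ?thesis using \<open>k \<ge> 2\<close> by simp
  qed
  fix l m
  have pow: "lookup (Var j ^ k :: ('n, 'k) mpoly) m = (if m = single j k then 1 else 0)" for m
    by (simp add: Var_power lookup_single when_def)
  show "lookup (elementary i (Const (lookup (h i) (single j k)) * Var j ^ k) l) m =
      (if wdeg ?a m = ?a l then lookup (h l) m else 0)"
  proof (cases "mdeg m < k")
    case True
    then have "m \<noteq> single j k" by auto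
    then show ?thesis
      using low[OF True, of l] wdeg_single[of ?a l 1]
      by (auto simp: elementary_def lookup_add lookup_Const_mult pow lookup_Var)
  next
    case False
    then have "m \<noteq> single l 1" for l
      using \<open>k \<ge> 2\<close> by auto
    moreover have "wdeg ?a (single j k) = 2 * k"
      by (simp add: wdeg_single)
    ultimately show ?thesis
      using False high[of m] higher[of m] \<open>k \<ge> 2\<close> \<open>i \<noteq> j\<close>
      by (auto simp: elementary_def lookup_add lookup_Const_mult pow lookup_Var)
  qed
qed

lemma power_shear_nonzero:
  assumes "h \<in> H" "\<And>l. order_ge k (h l - Var l)" "k \<ge> 2" "i \<noteq> j" "lookup (h i) (single j k) \<noteq> 0"
  shows "elementary i (Var j ^ k) \<in> H"
proof -
  let ?c = "lookup (h i) (single j k)"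
  have "i \<notin> vars (Const ?c * Var j ^ k)"
    using \<open>i \<noteq> j\<close> vars_mult[of "Const ?c" "Var j ^ k"] vars_Var_power[of j k] by auto
  from elementary_scale[OF power_shear[OF assms(1-4)] this, of "inverse ?c"] assms(5)
  show ?thesis by (simp flip: mult.assoc Const_mult)
qed

text \<open>
  The vector fields \<open>x\<^sub>j ^ k \<partial>\<^sub>i\<close> and \<open>(x\<^sub>i + x\<^sub>j)\<^sup>2 (\<partial>\<^sub>i - \<partial>\<^sub>j)\<close> have a bracket of degree \<open>k + 1\<close>;
  it is the lowest term of the commutator of \<open>\<sigma>\<close> and \<open>\<tau>\<close> below.
\<close>

lemma power_shear_Suc:
  assumes k: "k \<ge> 2" and ij: "i \<noteq> j"
    and H: "elementary i (Var j ^ k) \<in> H" "elementary i (Var j ^ 2) \<in> H"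
  shows "elementary i (Var j ^ Suc k) \<in> H"
proof -
  define q :: "('n, 'k) mpoly" where "q = (Var i + Var j) ^ 2"
  define \<sigma> \<sigma>' \<tau> \<tau>' :: "('n, 'k) endo"
    where "\<sigma> = elementary i (Var j ^ k)" and "\<sigma>' = elementary i (- (Var j ^ k))"
      and "\<tau> = Var(i := Var i + q, j := Var j - q)" and "\<tau>' = Var(i := Var i - q, j := Var j + q)"
  have i_notin: "i \<notin> vars (Var j ^ k :: ('n, 'k) mpoly)"
    using ij vars_Var_power[of j k] by auto
  have \<sigma>_inv: "\<sigma> \<bullet> \<sigma>' = Var" "\<sigma>' \<bullet> \<sigma> = Var"
    unfolding \<sigma>_def \<sigma>'_def using elementary_inverse[OF i_notin] by auto
  \<comment> \<open>\<open>\<tau>\<close> and \<open>\<tau>'\<close> add and subtract the same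
    \<open>q\<close> in two coordinates, so they fix \<open>x\<^sub>i + x\<^sub>j\<close> and its
    square.\<close>
  have "psubst \<tau> q = q" "psubst \<tau>' q = q"
    using ij by (simp_all add: q_def \<tau>_def \<tau>'_def psubst_simps)
  then have \<tau>_inv: "\<tau> \<bullet> \<tau>' = Var" "\<tau>' \<bullet> \<tau> = Var"
    using ij by (auto simp: fun_eq_iff comp_def \<tau>_def \<tau>'_def psubst_simps)
  \<comment> \<open>\<open>\<tau>\<close> is the quadratic shear conjugated by the linear shear
    \<open>x\<^sub>j \<mapsto> x\<^sub>j + x\<^sub>i\<close>.\<close>
  have "elementary j (- Var i) \<bullet> (elementary i (Var j ^ 2) \<bullet> elementary j (Var i)) = \<tau>"
    using ij by (auto simp: fun_eq_iff comp_def \<tau>_def elementary_def psubst_simps q_def add.commute)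
  moreover have "elementary j (Var i) \<in> H" "elementary j (- Var i) \<in> H"
    using ij Aff_subset
    by (auto intro!: subsetD[OF Aff_subset] elementary_in_Aff deg_le_intros simp del: One_nat_def)
  ultimately have "\<tau> \<in> H"
    using H(2) by (metis comp_in_H)
  have "\<sigma> \<in> H" "\<sigma>' \<in> H" "\<tau>' \<in> H"
    using H(1) inverse_in_H[OF _ \<sigma>_inv] inverse_in_H[OF \<open>\<tau> \<in> H\<close> \<tau>_inv] by (auto simp: \<sigma>_def)
  define \<rho> where "\<rho> = \<sigma>' \<bullet> \<tau>'"
  define h where "h = \<sigma> \<bullet> \<tau> \<bullet> \<rho>"
  have "h \<in> H"
    unfolding h_def \<rho>_def using \<open>\<sigma> \<in> H\<close> \<open>\<sigma>' \<in> H\<close> \<open>\<tau> \<in> H\<close> \<open>\<tau>' \<in> H\<close> by (intro comp_in_H)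
  \<comment> \<open>Since \<open>\<tau> \<bullet> \<sigma> \<bullet> \<rho>\<close> is the identity,
    the commutator \<open>h\<close> differs from the identity by \<open>D\<close> composed with
    \<open>\<rho>\<close>. As \<open>\<rho>\<close> is tangent to the identity, \<open>D\<close>
    already shows the lowest term and the commutator need not be expanded.\<close>
  define D where "D = (\<lambda>l. (\<sigma> \<bullet> \<tau>) l - (\<tau> \<bullet> \<sigma>) l)"
  have "\<tau> \<bullet> \<sigma> \<bullet> \<rho> = Var"
    unfolding \<rho>_def by (metis comp_assoc comp_Var(1) \<sigma>_inv(1) \<tau>_inv(1))
  then have h_D: "h l - Var l = psubst \<rho> (D l)" for l
    by (simp add: h_def D_def psubst_simps comp_def fun_eq_iff)
  define u v w :: "('n, 'k) mpoly"
    where "u = Var i + Var j" and "v = Var j ^ k" and "w = (u + u + v) * v"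
  have w: "psubst \<sigma> q - q = w"
    using ij by (simp add: \<sigma>_def elementary_def q_def psubst_simps u_def v_def w_def)
      (simp add: power2_eq_square algebra_simps)
  have D: "D l = (if l = i then psubst \<tau> v - v - w else if l = j then w else 0)" for l
    unfolding w[symmetric] D_def comp_def \<tau>_def \<sigma>_def elementary_def v_def
    using ij by (simp add: psubst_simps)
  have q2: "order_ge 2 q"
    unfolding q_def using order_ge_power[OF order_ge_add[OF order_ge_Var order_ge_Var], of 2] by simp
  have vk: "order_ge k v"
    unfolding v_def using order_ge_power[OF order_ge_Var, of k] by simp
  have "order_ge (1 + k) w"
    unfolding w_def u_def using vk k
    by (intro order_ge_mult order_ge_add)
      (auto intro!: order_ge_add order_ge_Var simp del: One_nat_def intro: order_ge_mono)
  then have w_ord: "order_ge (Suc k) w" by simp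
  have \<tau>2: "order_ge 2 (\<tau> l - Var l)" "order_ge 2 (\<tau>' l - Var l)" for l
    using q2 by (auto simp: \<tau>_def \<tau>'_def order_ge_uminus)
  have \<sigma>'2: "order_ge 2 (\<sigma>' l - Var l)" for l
    using order_ge_mono[OF vk k] by (auto simp: \<sigma>'_def elementary_def v_def order_ge_uminus)
  have \<rho>2: "order_ge 2 (\<rho> l - Var l)" for l
    unfolding \<rho>_def by (rule order_ge_comp_diff) (rule \<sigma>'2 \<tau>2)+
  have \<rho>1: "order_ge 1 (\<rho> l)" for l
    using \<rho>2 by (rule order_ge_1_of_diff)
  have D_ord: "order_ge (Suc k) (D l)" for l
    using w_ord order_ge_psubst_diff[OF vk \<tau>2(1)] by (auto simp: D intro: order_ge_diff)
  then have h_ord: "order_ge (Suc k) (h l - Var l)" for l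
    unfolding h_D using \<rho>1 by (rule order_ge_psubst)
  let ?m = "single j (Suc k)"
  define X :: "'k poly" where "X = [:0, 1:]"
  have line_Var: "line j (Var j) = X" "line j (Var i) = 0"
    using ij by (simp_all add: line_simps X_def)
  have m_ne: "?m \<noteq> single i 1"
    using k by (auto dest: arg_cong[where f = mdeg])
  \<comment> \<open>Composition with \<open>\<rho>\<close> changes \<open>D i\<close> only from
    degree \<open>k + 2\<close> on, so the coefficient of \<open>x\<^sub>j ^ (k + 1)\<close> can be
    read off \<open>D i\<close> on the \<open>j\<close>-th axis.\<close>
  have "lookup (psubst \<rho> (D i) - D i) ?m = 0"
    using order_ge_psubst_diff[OF D_ord \<rho>2] by (rule order_ge_lookup) simp
  then have "lookup (h i - Var i) ?m = coeff (line j (D i)) (Suc k)"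
    unfolding h_D coeff_line by (simp add: lookup_minus)
  also have "line j (D i) = (X - X ^ 2) ^ k - X ^ k - (2 * X + X ^ k) * X ^ k"
  proof -
    have "D i = (Var j - q) ^ k - v - (u + u + v) * v"
      unfolding D using ij by (simp add: w_def v_def psubst_simps) (simp add: \<tau>_def)
    then show ?thesis
      by (simp only: line_simps(1-4) line_Var u_def v_def q_def mult_2 add_0_left)
  qed
  also have "\<dots> = monom 1 k * ([:1, -1:] ^ k - 1 - 2 * X - monom 1 k)"
  proof -
    have "X - X ^ 2 = X * [:1, -1:]"
      by (simp add: X_def power2_eq_square)
    then have *: "(X - X ^ 2) ^ k = X ^ k * [:1, -1:] ^ k"
      by (simp only: power_mult_distrib)
    have "monom 1 k = X ^ k" by (simp add: monom_altdef X_def)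
    then show ?thesis unfolding * by (simp only: algebra_simps mult_1_right mult_1_left)
  qed
  \<comment> \<open>The power of \<open>1 - X\<close> contributes \<open>- k\<close> and
    \<open>2 * X\<close> contributes \<open>- 2\<close>; \<open>monom 1 k\<close> contributes
    nothing since \<open>k \<ge> 2\<close>. The total is nonzero in characteristic zero.\<close>
  also have "coeff \<dots> (Suc k) = - of_nat (k + 2)"
    using k coeff_one_minus_power[of k] by (simp add: coeff_monom_mult numeral_poly X_def)
  finally have "lookup (h i) ?m = - of_nat (k + 2)"
    using m_ne by (simp add: lookup_minus lookup_Var)
  then have "lookup (h i) ?m \<noteq> 0"
    by (simp only: neg_equal_0_iff_equal of_nat_eq_0_iff)
  then show ?thesis
    using power_shear_nonzero[OF \<open>h \<in> H\<close> h_ord] k ij by simp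
qed

lemma power_shears:
  assumes ij: "i \<noteq> j" and H: "elementary i (Var j ^ 2) \<in> H"
  shows "elementary i (Var j ^ k) \<in> H"
proof (cases "k \<ge> 2")
  case True
  then show ?thesis
  proof (induction k rule: dec_induct)
    case (step k)
    then show ?case using power_shear_Suc[OF _ ij _ H] by blast
  qed (rule H)
next
  case False
  then have "k = 0 \<or> k = 1" by auto
  then have "deg_le 1 (Var j ^ k :: ('n, 'k) mpoly)"
    using deg_le_Var[of j] deg_le_Const[of 1 1] by auto
  then show ?thesis
    using ij vars_Var_power[of j k] by (intro subsetD[OF Aff_subset] elementary_in_Aff) auto
qed

end

section \<open>Quadratic shears\<close>

lemma order_geI: "(\<And>m. mdeg m < k \<Longrightarrow> lookup p m = 0) \<Longrightarrow> order_ge k p"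
  unfolding order_ge_def by (metis in_keys_iff linorder_not_less)

lemma single_1_eq_iff: "single i (1::nat) = single j 1 \<longleftrightarrow> i = j"
  by (auto dest: arg_cong[where f = keys])

section \<open>Linear parts and the Jacobian matrix at the origin\<close>

definition linear_endo :: "('n \<Rightarrow> 'n \<Rightarrow> 'k) \<Rightarrow> ('n::finite, 'k::field) endo" where
  "linear_endo A = (\<lambda>l. \<Sum>m\<in>UNIV. Const (A l m) * Var m)"

lemma lookup_sum_Var:
  fixes a :: "'n::finite \<Rightarrow> 'k::comm_ring_1"
  shows "lookup (\<Sum>m\<in>UNIV. Const (a m) * Var m) (single i 1) = a i"
    and "mdeg x \<noteq> 1 \<Longrightarrow> lookup (\<Sum>m\<in>UNIV. Const (a m) * Var m) x = 0"
proof -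
  have "lookup (\<Sum>m\<in>UNIV. Const (a m) * Var m) (single i 1) = (\<Sum>m\<in>UNIV. if m = i then a i else 0)"
    unfolding lookup_sum lookup_Const_mult lookup_Var
    by (intro sum.cong) (auto simp: single_1_eq_iff simp del: One_nat_def)
  then show "lookup (\<Sum>m\<in>UNIV. Const (a m) * Var m) (single i 1) = a i" by simp
  show "lookup (\<Sum>m\<in>UNIV. Const (a m) * Var m) x = 0" if "mdeg x \<noteq> 1"
    using that by (auto simp: lookup_sum lookup_Const_mult lookup_Var intro!: sum.neutral)
qed

lemma linear_part:
  fixes p :: "('n::finite, 'k::comm_ring_1) mpoly"
  assumes "order_ge 1 p"
  shows "order_ge 2 (p - (\<Sum>m\<in>UNIV. Const (lookup p (single m 1)) * Var m))"
proof (rule order_geI)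
  fix x :: "'n \<Rightarrow>\<^sub>0 nat" assume "mdeg x < 2"
  then consider "mdeg x < 1" | "mdeg x = 1" by linarith
  then show "lookup (p - (\<Sum>m\<in>UNIV. Const (lookup p (single m 1)) * Var m)) x = 0"
  proof cases
    case 1
    then show ?thesis
      using order_ge_lookup[OF assms 1] lookup_sum_Var(2)[of x] by (simp add: lookup_minus)
  next
    case 2
    then obtain i where "x = single i 1" using mdeg_eq_1D by blast
    then show ?thesis
      using lookup_sum_Var(1)[of "\<lambda>m. lookup p (single m 1)" i] by (simp add: lookup_minus)
  qed
qed

text \<open>This is the chain rule at the origin: what remains of \<open>p\<close> after subtracting
  its linear part has order 2, and keeps it under substitution.\<close>

lemma lookup_psubst_linear:
  fixes p :: "('n::finite, 'k::comm_ring_1) mpoly" and g :: "'n \<Rightarrow> ('n, 'k) mpoly"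
  assumes "order_ge 1 p" "\<And>i. order_ge 1 (g i)"
  shows "lookup (psubst g p) (single j 1) =
      (\<Sum>m\<in>UNIV. lookup p (single m 1) * lookup (g m) (single j 1))"
proof -
  have "order_ge 2 (psubst g (p - (\<Sum>m\<in>UNIV. Const (lookup p (single m 1)) * Var m)))"
    by (intro order_ge_psubst linear_part assms)
  then have "lookup (psubst g (p - (\<Sum>m\<in>UNIV. Const (lookup p (single m 1)) * Var m))) (single j 1) = 0"
    by (rule order_ge_lookup) simp
  then show ?thesis
    by (simp add: psubst_simps lookup_minus lookup_sum lookup_Const_mult)
qed

lemma linear_endo_comp:
  "linear_endo B \<bullet> linear_endo A = linear_endo (\<lambda>l j. \<Sum>m\<in>UNIV. B l m * A m j)"
proof
  fix l
  have "(linear_endo B \<bullet> linear_endo A) l =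
      (\<Sum>m\<in>UNIV. \<Sum>j\<in>UNIV. Const (B l m * A m j) * Var j)"
    by (simp add: linear_endo_def comp_def psubst_simps sum_distrib_left Const_mult mult.assoc)
  also have "\<dots> = (\<Sum>j\<in>UNIV. \<Sum>m\<in>UNIV. Const (B l m * A m j) * Var j)"
    by (rule sum.swap)
  also have "\<dots> = linear_endo (\<lambda>l j. \<Sum>m\<in>UNIV. B l m * A m j) l"
    by (simp add: linear_endo_def psubst.hom_sum sum_distrib_right)
  finally show "(linear_endo B \<bullet> linear_endo A) l = \<dots>" .
qed

lemma linear_endo_id: "linear_endo (\<lambda>l j. if l = j then 1 else 0) = Var"
proof
  fix l
  have "linear_endo (\<lambda>l j. if l = j then 1 else 0) l = (\<Sum>m\<in>UNIV. if l = m then Var m else 0)"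
    unfolding linear_endo_def by (intro sum.cong) auto
  then show "linear_endo (\<lambda>l j. if l = j then 1 else 0) l = Var l" by simp
qed

text \<open>The inverse automorphism also fixes the origin, so the chain rule makes its linear part
  a two-sided inverse matrix.\<close>

lemma jacobian_at_0_invertible:
  fixes h :: "('n::finite, 'k::field) endo"
  assumes "h \<in> carrier GA" and h0: "\<And>l. order_ge 1 (h l)"
  shows "\<exists>B. \<forall>l j. (\<Sum>m\<in>UNIV. B l m * lookup (h m) (single j 1)) = (if l = j then 1 else 0) \<and>
    (\<Sum>m\<in>UNIV. lookup (h l) (single m 1) * B m j) = (if l = j then 1 else 0)"
proof -
  obtain g where g: "h \<bullet> g = Var" "g \<bullet> h = Var"
    using assms(1) by (auto simp: carrier_GA)
  \<comment> \<open>Substituting \<open>h\<close> into \<open>g l\<close> minus its constant term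
    leaves \<open>x\<^sub>l\<close> minus that constant, still without constant term; hence the
    constant is 0.\<close>
  have g0: "order_ge 1 (g l)" for l
  proof -
    let ?c = "Const (lookup (g l) 0) :: ('n, 'k) mpoly"
    have "order_ge 1 (g l - ?c)"
      by (simp add: order_ge_1_iff lookup_minus lookup_Const del: One_nat_def)
    then have "order_ge 1 (psubst h (g l - ?c))"
      using h0 by (rule order_ge_psubst)
    moreover have "psubst h (g l) = Var l"
      using g(2) by (metis comp_def)
    ultimately have "order_ge 1 (Var l - ?c)"
      by (simp add: psubst_simps)
    then have "order_ge 1 (Var l - (Var l - ?c))"
      by (rule order_ge_diff[OF order_ge_Var])
    then show ?thesis
      by (simp add: order_ge_1_iff lookup_Const del: One_nat_def)
  qed
  have \<delta>: "lookup (Var l :: ('n, 'k) mpoly) (single j 1) = (if l = j then 1 else 0)" for l j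
    by (auto simp: lookup_Var single_1_eq_iff simp del: One_nat_def)
  show ?thesis
  proof (intro exI[of _ "\<lambda>l m. lookup (g l) (single m 1)"] allI conjI)
    fix l j
    show "(\<Sum>m\<in>UNIV. lookup (g l) (single m 1) * lookup (h m) (single j 1)) = (if l = j then 1 else 0)"
      using lookup_psubst_linear[of "g l" h j, OF g0 h0] fun_cong[OF g(2), of l] \<delta>[of l j] by (simp add: comp_def)
    show "(\<Sum>m\<in>UNIV. lookup (h l) (single m 1) * lookup (g m) (single j 1)) = (if l = j then 1 else 0)"
      using lookup_psubst_linear[of "h l" g j, OF h0 g0] fun_cong[OF g(1), of l] \<delta>[of l j] by (simp add: comp_def)
  qed
qed

text \<open>The hypothesis says that the image of the \<open>j\<close>-th axis has acceleration not
  parallel to its velocity at the origin. Normalising the linear part to the identity turns the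
  velocity into the \<open>j\<close>-th unit vector, so the acceleration has a nonzero component off
  \<open>j\<close>.\<close>

lemma (in closed_subgroup_above_Aff) quadratic_shear_at_0:
  assumes h: "h \<in> H" and h0: "\<And>l. order_ge 1 (h l)"
    and not_parallel: "lookup (h m) (single j 2) * lookup (h p) (single j 1) \<noteq>
      lookup (h p) (single j 2) * lookup (h m) (single j 1)"
  shows "\<exists>i. i \<noteq> j \<and> elementary i (Var j ^ 2) \<in> H"
proof -
  define A where "A = (\<lambda>l m. lookup (h l) (single m 1))"
  obtain B where BA: "\<And>l j. (\<Sum>m\<in>UNIV. B l m * A m j) = (if l = j then 1 else 0)"
    and AB: "\<And>l j. (\<Sum>m\<in>UNIV. A l m * B m j) = (if l = j then 1 else 0)"
    using jacobian_at_0_invertible[OF in_GA[OF h] h0] unfolding A_def by blast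
  have inv: "linear_endo B \<bullet> linear_endo A = Var" "linear_endo A \<bullet> linear_endo B = Var"
    by (simp_all add: linear_endo_comp AB BA linear_endo_id)
  have "linear_endo B \<in> Aff"
    using inv by (intro AffI[of _ "linear_endo A"])
      (auto simp: linear_endo_def simp del: One_nat_def intro!: deg_le_intros)
  define h' where "h' = linear_endo B \<bullet> h"
  have h'_eq: "h' l = (\<Sum>m\<in>UNIV. Const (B l m) * h m)" for l
    by (simp add: h'_def comp_def linear_endo_def psubst_simps)
  have "h' \<in> H"
    unfolding h'_def by (intro comp_in_H h subsetD[OF Aff_subset] \<open>linear_endo B \<in> Aff\<close>)
  have h'_order: "order_ge 2 (h' l - Var l)" for l
  proof -
    have "Var l = (linear_endo B \<bullet> linear_endo A) l"
      by (simp add: inv)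
    also have "\<dots> = (\<Sum>m\<in>UNIV. Const (B l m) * linear_endo A m)"
      by (simp add: comp_def linear_endo_def[of B] psubst_simps)
    finally have "h' l - Var l = (\<Sum>m\<in>UNIV. Const (B l m) * (h m - linear_endo A m))"
      by (simp add: h'_eq right_diff_distrib sum_subtractf)
    also have "order_ge 2 \<dots>"
      unfolding linear_endo_def A_def
      by (intro order_ge_sum order_ge_Const_mult linear_part h0)
    finally show ?thesis .
  qed
  have "\<exists>i. i \<noteq> j \<and> lookup (h' i) (single j 2) \<noteq> 0"
  proof (rule ccontr)
    \<comment> \<open>Otherwise the normalised acceleration \<open>w\<close> is concentrated in
      component \<open>j\<close>; multiplying by \<open>A\<close> makes the original acceleration
      \<open>w j\<close> times the velocity.\<close>
    assume *: "\<not> ?thesis"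
    define w where "w = (\<lambda>l. lookup (h' l) (single j 2))"
    have "lookup (h x) (single j 2) = A x j * w j" for x
    proof -
      have "(\<Sum>l\<in>UNIV. A x l * w l) = (\<Sum>l\<in>UNIV. \<Sum>y\<in>UNIV. A x l * B l y * lookup (h y) (single j 2))"
        by (simp add: w_def h'_eq lookup_sum lookup_Const_mult sum_distrib_left mult.assoc)
      also have "\<dots> = (\<Sum>y\<in>UNIV. (\<Sum>l\<in>UNIV. A x l * B l y) * lookup (h y) (single j 2))"
        by (subst sum.swap) (simp add: sum_distrib_right)
      also have "\<dots> = (\<Sum>y\<in>UNIV. if x = y then lookup (h y) (single j 2) else 0)"
        by (intro sum.cong) (auto simp: AB)
      finally have "lookup (h x) (single j 2) = (\<Sum>l\<in>UNIV. A x l * w l)" by simp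
      also have "\<dots> = (\<Sum>l\<in>UNIV. if l = j then A x j * w j else 0)"
        using * by (intro sum.cong) (auto simp: w_def)
      finally show ?thesis by simp
    qed
    then show False
      using not_parallel by (simp add: A_def mult_ac)
  qed
  then show ?thesis
    using power_shear_nonzero[OF \<open>h' \<in> H\<close> h'_order] by auto
qed

section \<open>Second-order behaviour of curves\<close>

lemma line_translation:
  "line j (psubst (\<lambda>l. Var l + Const (if l = j then r else 0)) p) = pcompose (line j p) [:r, 1:]"
proof -
  have pc: "coeff_hom (\<lambda>q. pcompose q [:r, 1:])"
    by unfold_locales (simp_all add: pcompose_add pcompose_mult pcompose_1)
  show ?thesis
    unfolding line_def
    by (subst eval_hom_psubst[OF coeff_hom_pConst], subst coeff_hom.hom_eval_hom[OF pc],
        rule pcompose_const)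
      (auto intro!: eval_hom_cong simp: pconst.eval_hom_add pconst.eval_hom_Var
        pconst.eval_hom_Const pcompose_pCons)
qed

lemma taylor_coeffs:
  fixes c :: "'k::field_char_0 poly"
  shows "coeff (pcompose c [:r, 1:]) 1 = poly (pderiv c) r"
    and "2 * coeff (pcompose c [:r, 1:]) 2 = poly (pderiv (pderiv c)) r"
proof -
  have d: "pderiv (pcompose p [:r, 1:]) = pcompose (pderiv p) [:r, 1:]" for p
    by (simp add: pderiv_pcompose pderiv_pCons)
  have 0: "coeff (pcompose p [:r, 1:]) 0 = poly p r" for p
    by (simp flip: poly_0_coeff_0 add: poly_pcompose)
  show "coeff (pcompose c [:r, 1:]) 1 = poly (pderiv c) r"
    using coeff_pderiv[of "pcompose c [:r, 1:]" 0] by (simp add: d 0)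
  show "2 * coeff (pcompose c [:r, 1:]) 2 = poly (pderiv (pderiv c)) r"
    using coeff_pderiv[of "pderiv (pcompose c [:r, 1:])" 0] coeff_pderiv[of "pcompose c [:r, 1:]" 1]
    by (simp add: d 0 numeral_2_eq_2)
qed

text \<open>If the Wronskian of \<open>?a\<close> and \<open>?b\<close> vanished identically, then
  at a root of \<open>?a\<close> that is no root of \<open>?b\<close> the multiplicity of
  \<open>pderiv ?a\<close> would be at least that of \<open>?a\<close>, whereas it is one less. The
  point in the conclusion is one where the Wronskian is nonzero, not necessarily that root.\<close>

lemma curve_with_acceleration:
  fixes c :: "'n \<Rightarrow> 'k::{alg_closed_field, field_char_0} poly"
  assumes immersed: "\<And>r. \<exists>p. poly (pderiv (c p)) r \<noteq> 0" and "degree (c m) \<ge> 2"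
  shows "\<exists>r p. poly (pderiv (pderiv (c m))) r * poly (pderiv (c p)) r \<noteq>
      poly (pderiv (pderiv (c p))) r * poly (pderiv (c m)) r"
proof -
  let ?a = "pderiv (c m)"
  have deg: "degree ?a > 0" using assms(2) by (simp add: degree_pderiv)
  then obtain r where r: "poly ?a r = 0"
    using alg_closed_imp_poly_has_root by blast
  obtain p where p: "poly (pderiv (c p)) r \<noteq> 0" using immersed by blast
  let ?b = "pderiv (c p)"
  have "pderiv ?a * ?b \<noteq> pderiv ?b * ?a"
  proof
    assume eq: "pderiv ?a * ?b = pderiv ?b * ?a"
    have "?b \<noteq> 0" using p by auto
    moreover have "pderiv ?a \<noteq> 0" using deg by (simp add: pderiv_eq_0_iff)
    ultimately have nz: "pderiv ?a * ?b \<noteq> 0" by simp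
    have "Polynomial.order r ?a = Suc (Polynomial.order r (pderiv ?a))"
      using deg r by (intro order_pderiv) auto
    moreover have "Polynomial.order r ?b = 0" using p order_root by blast
    moreover have "Polynomial.order r (pderiv ?a) + Polynomial.order r ?b = Polynomial.order r (pderiv ?b) + Polynomial.order r ?a"
      using order_mult[OF nz, of r] order_mult[of "pderiv ?b" ?a r] nz unfolding eq by simp
    ultimately show False by simp
  qed
  then have "poly (pderiv ?a * ?b) \<noteq> poly (pderiv ?b * ?a)"
    by (simp only: poly_eq_poly_eq_iff not_False_eq_True)
  then show ?thesis by (auto simp: fun_eq_iff)
qed

section \<open>Subspaces stable under diagonal substitutions\<close>

text \<open>Eigenvalue separation: a combination of \<open>p\<close> with one of its dilations
  cancels an unwanted monomial and keeps \<open>m\<close>, so induction on the size of the support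
  applies.\<close>

lemma monomial_in_subspace:
  fixes p :: "('n::finite, 'k::field_char_0) mpoly"
  assumes add: "\<And>p q. P p \<Longrightarrow> P q \<Longrightarrow> P (p + q)"
    and scale: "\<And>c p. P p \<Longrightarrow> P (Const c * p)"
    and dilate: "\<And>b p. P p \<Longrightarrow> (\<And>i. b i \<noteq> 0) \<Longrightarrow> P (psubst (dilation b) p)"
    and "P p" "m \<in> keys p"
  shows "P (single m 1)"
  using \<open>P p\<close> \<open>m \<in> keys p\<close>
proof (induction "card (keys p)" arbitrary: p rule: less_induct)
  case less
  show ?case
  proof (cases "keys p = {m}")
    case True
    have "Const (inverse (lookup p m)) * p = single m 1"
      using True by (intro poly_mapping_eqI)
        (auto simp: lookup_Const_mult lookup_single when_def in_keys_iff set_eq_iff)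
    then show ?thesis using scale[OF less.prems(1)] by metis
  next
    case False
    then obtain m' where m': "m' \<in> keys p" "m' \<noteq> m"
      using less.prems(2) by blast
    then obtain l where l: "lookup m l \<noteq> lookup m' l"
      using poly_mapping_eqI by metis
    \<comment> \<open>Scaling a variable in which \<open>m\<close> and \<open>m'\<close> have
      different exponents by 2 separates them, because the powers of 2 are distinct in
      characteristic zero.\<close>
    define b where "b = (\<lambda>i. if i = l then 2 else 1 :: 'k)"
    define q where "q = psubst (dilation b) p + Const (- (2 ^ lookup m' l)) * p"
    have "(\<Prod>i\<in>UNIV. b i ^ lookup x i) = 2 ^ lookup x l" for x
    proof -
      have "(\<Prod>i\<in>UNIV. b i ^ lookup x i) = (\<Prod>i\<in>UNIV. if i = l then 2 ^ lookup x l else 1)"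
        unfolding b_def by (intro prod.cong) auto
      then show ?thesis by simp
    qed
    then have q: "lookup q x = (2 ^ lookup x l - 2 ^ lookup m' l) * lookup p x" for x
      by (simp add: q_def lookup_add lookup_psubst_dilation lookup_Const_mult left_diff_distrib)
    have pow: "(2::'k) ^ a = 2 ^ b \<longleftrightarrow> a = b" for a b :: nat
      using of_nat_eq_iff[of "2 ^ a" "2 ^ b", where ?'a = 'k] by simp
    have "keys q \<subset> keys p"
      using m' by (auto simp: in_keys_iff q)
    then have "card (keys q) < card (keys p)"
      by (simp add: psubset_card_mono)
    moreover have "P q"
      unfolding q_def using less.prems(1) by (intro add dilate scale) (auto simp: b_def)
    moreover have "m \<in> keys q"
      using less.prems(2) l by (simp add: in_keys_iff q pow)
    ultimately show ?thesis by (rule less.hyps)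
  qed
qed

text \<open>The polynomials of degree at most 1 along all these lines form a subspace stable under
  diagonal substitutions. If it contained \<open>p\<close>, it would contain the monomial
  \<open>m\<close>, which on the diagonal line is \<open>t ^ mdeg m\<close>.\<close>

lemma line_of_high_degree:
  fixes p :: "('n::finite, 'k::field_char_0) mpoly"
  assumes "m \<in> keys p" "mdeg m \<ge> 2"
  shows "\<exists>u. (\<forall>i. u i \<noteq> 0) \<and> degree (eval_hom (\<lambda>c. [:c:]) (\<lambda>i. [:0, u i:]) p) \<ge> 2"
proof (rule ccontr)
  define E where "E = (\<lambda>u. eval_hom (\<lambda>c. [:c:]) (\<lambda>i. [:0, u i:]) :: ('n, 'k) mpoly \<Rightarrow> 'k poly)"
  define P where "P = (\<lambda>p. \<forall>u. (\<forall>i. u i \<noteq> 0) \<longrightarrow> degree (E u p) \<le> 1)"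
  assume "\<not> ?thesis"
  then have "P p" by (auto simp: P_def E_def not_le less_Suc_eq_le numeral_2_eq_2)
  have "P (single m 1)"
  proof (rule monomial_in_subspace[where P = P])
    show "P p" "m \<in> keys p" by fact+
    show "P (p + q)" if "P p" "P q" for p q
      using that by (auto simp: P_def E_def pconst.eval_hom_add intro!: degree_add_le)
    show "P (Const c * p)" if "P p" for c p
      using that by (auto simp: P_def E_def pconst.eval_hom_mult pconst.eval_hom_Const
          intro: order_trans[OF degree_smult_le])
    show "P (psubst (dilation b) p)" if "P p" "\<And>i. b i \<noteq> 0" for b p
    proof -
      have "E u (psubst (dilation b) p) = E (\<lambda>i. b i * u i) p" for u
        by (simp add: E_def eval_hom_psubst[OF coeff_hom_pConst] dilation_def pconst.eval_hom_mult
            pconst.eval_hom_Const pconst.eval_hom_Var mult.commute)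
      then show ?thesis using that by (simp add: P_def)
    qed
  qed
  then have "degree (E (\<lambda>_. 1) (single m 1)) \<le> 1"
    by (simp add: P_def)
  moreover have "E (\<lambda>_. 1) (single m 1) = monom 1 (mdeg m)"
    by (simp add: E_def pconst.eval_hom_single monom_eval_def mdeg_def power_sum[symmetric] monom_altdef)
  ultimately show False using assms(2) by (simp add: degree_monom_eq)
qed

lemma quadratic_shear_exists:
  fixes H :: "('n::finite, 'k::{alg_closed_field, field_char_0}) endo set"
  assumes "closed_subgroup_above_Aff H" "h \<in> H" "h \<notin> Aff"
  shows "\<exists>i. i \<noteq> j \<and> elementary i (Var j ^ 2) \<in> H"
proof -
  interpret closed_subgroup_above_Aff H by fact
  have "endo_deg h \<noteq> 1" "endo_deg h \<ge> 1"
    using assms(2,3) in_GA[OF assms(2)] endo_deg_pos[of h] by (auto simp: Aff_def)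
  then have "\<not> endo_deg h \<le> 1" by simp
  then obtain m x where "x \<in> keys (h m)" "mdeg x \<ge> 2"
    by (auto simp: endo_deg_le_iff deg_le_def)
  then obtain u where u: "\<And>i. u i \<noteq> 0"
    and deg: "degree (eval_hom (\<lambda>c. [:c:]) (\<lambda>i. [:0, u i:]) (h m)) \<ge> 2"
    using line_of_high_degree by blast
  \<comment> \<open>\<open>N\<close> maps the \<open>j\<close>-th axis to the diagonal line, so
    \<open>dilation u \<bullet> N\<close> maps it to the line with direction
    \<open>u\<close>.\<close>
  define N :: "('n, 'k) endo" where "N = (\<lambda>l. Var l + (if l = j then 0 else Var j))"
  have "N \<in> Aff"
    by (rule AffI[of _ "\<lambda>l. Var l - (if l = j then 0 else Var j)"])
      (auto simp: N_def comp_def fun_eq_iff psubst_simps simp del: One_nat_def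
        intro!: deg_le_intros deg_le_Const[of 1 0, simplified])
  define f where "f = h \<bullet> (dilation u \<bullet> N)"
  have "f \<in> H"
    unfolding f_def
    by (intro comp_in_H \<open>h \<in> H\<close> subsetD[OF Aff_subset] \<open>N \<in> Aff\<close> dilation_in_Aff u)
  define c where "c = (\<lambda>l. line j (f l))"
  have "line j ((dilation u \<bullet> N) l) = [:0, u l:]" for l
    by (simp add: dilation_comp_left N_def line_simps)
      (simp add: line_def pconst.eval_hom_0)
  then have "degree (c m) \<ge> 2"
    using deg eval_hom_psubst[OF coeff_hom_pConst, of _ "dilation u \<bullet> N" "h m"]
    by (simp add: c_def f_def comp_def[of h] line_def)
  \<comment> \<open>\<open>T r\<close> moves the origin to the point \<open>r\<close> of the
    \<open>j\<close>-th axis; the translation in \<open>g r\<close> brings its image back to the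
    origin.\<close>
  define T where "T = (\<lambda>r l. Var l + Const (if l = j then r else 0) :: ('n, 'k) mpoly)"
  define g where "g = (\<lambda>r l. (f \<bullet> T r) l + Const (- lookup ((f \<bullet> T r) l) 0))"
  have "g r \<in> H" for r
  proof -
    have "g r = (\<lambda>l. Var l + Const (- lookup ((f \<bullet> T r) l) 0)) \<bullet> (f \<bullet> T r)"
      by (simp add: g_def comp_def[of _ "f \<bullet> T r"] psubst_simps)
    moreover have "T r \<in> H" "(\<lambda>l. Var l + Const (- lookup ((f \<bullet> T r) l) 0)) \<in> H"
      unfolding T_def by (intro subsetD[OF Aff_subset] translation_in_Aff)+
    ultimately show ?thesis
      using \<open>f \<in> H\<close> by (simp only: comp_in_H)
  qed
  have g0: "order_ge 1 (g r l)" for r l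
    by (simp add: order_ge_1_iff g_def lookup_add lookup_Const del: One_nat_def)
  have g_coeff: "lookup (g r l) (single j k) = coeff (pcompose (c l) [:r, 1:]) k" if "k > 0" for r l k
  proof -
    have "single j k \<noteq> 0" using that by (auto dest: arg_cong[where f = mdeg])
    then have "lookup (g r l) (single j k) = coeff (line j (psubst (T r) (f l))) k"
      by (simp add: g_def coeff_line lookup_add lookup_Const comp_def)
    then show ?thesis
      unfolding T_def line_translation c_def .
  qed
  \<comment> \<open>The velocity at \<open>r\<close> is column \<open>j\<close> of the invertible
    Jacobian matrix of \<open>g r\<close>, so it cannot vanish.\<close>
  have "\<exists>p. poly (pderiv (c p)) r \<noteq> 0" for r
  proof (rule ccontr)
    assume *: "\<not> ?thesis"
    obtain B where B: "\<And>l i. (\<Sum>m\<in>UNIV. B l m * lookup (g r m) (single i 1)) = (if l = i then 1 else 0)"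
      using jacobian_at_0_invertible[OF in_GA[OF \<open>g r \<in> H\<close>] g0] by blast
    have "lookup (g r p) (single j 1) = 0" for p
      using * by (simp add: g_coeff taylor_coeffs(1)[unfolded One_nat_def])
    then show False using B[of j j] by simp
  qed
  then obtain r p where "poly (pderiv (pderiv (c m))) r * poly (pderiv (c p)) r \<noteq>
      poly (pderiv (pderiv (c p))) r * poly (pderiv (c m)) r"
    using curve_with_acceleration[of c m] \<open>degree (c m) \<ge> 2\<close> by blast
  then have "lookup (g r m) (single j 2) * lookup (g r p) (single j 1) \<noteq>
      lookup (g r p) (single j 2) * lookup (g r m) (single j 1)"
    unfolding taylor_coeffs(2)[symmetric] unfolding taylor_coeffs(1)[symmetric]
    by (simp add: g_coeff)
  then show ?thesis
    by (rule quadratic_shear_at_0[OF \<open>g r \<in> H\<close> g0])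
qed

section \<open>All shears\<close>

context closed_subgroup_above_Aff
begin

text \<open>\<open>\<alpha>\<close> and its inverse fix \<open>x\<^sub>i\<close>, and the other
  components of \<open>\<beta>\<close> are free of \<open>x\<^sub>i\<close>. Conjugation therefore
  stays among the shears of \<open>x\<^sub>i\<close> and acts on \<open>p\<close> by
  substitution.\<close>

lemma elementary_conj:
  assumes "elementary i p \<in> H" "\<alpha> \<in> H" "\<alpha> \<bullet> \<beta> = Var" "\<beta> \<bullet> \<alpha> = Var"
    and "\<alpha> i = Var i" "\<beta> i = Var i" "\<And>l. l \<noteq> i \<Longrightarrow> i \<notin> vars (\<beta> l)"
  shows "elementary i (psubst \<alpha> p) \<in> H"
proof -
  let ?\<gamma> = "\<alpha>(i := Var i + psubst \<alpha> p)"
  have "elementary i p \<bullet> \<alpha> = ?\<gamma>"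
    using assms(5) by (auto simp: comp_def elementary_def fun_eq_iff psubst_simps)
  moreover have "(\<beta> \<bullet> ?\<gamma>) l = elementary i (psubst \<alpha> p) l" for l
  proof (cases "l = i")
    case False
    then have "psubst ?\<gamma> (\<beta> l) = psubst \<alpha> (\<beta> l)"
      using assms(7) by (intro psubst_cong) auto
    also have "\<dots> = Var l" using assms(4) by (metis comp_def)
    finally show ?thesis using False by (simp add: comp_def elementary_def)
  qed (simp add: comp_def assms(6) psubst_Var elementary_def)
  ultimately have "\<beta> \<bullet> (elementary i p \<bullet> \<alpha>) = elementary i (psubst \<alpha> p)"
    by (simp only: ext)
  then show ?thesis
    using assms(1,2) inverse_in_H[OF assms(2-4)] by (metis comp_in_H)
qed

lemma elementary_dilate:
  assumes "elementary i p \<in> H" "i \<notin> vars p" "\<And>l. b l \<noteq> 0"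
  shows "elementary i (psubst (dilation b) p) \<in> H"
proof -
  \<comment> \<open>\<open>elementary_conj\<close> needs \<open>x\<^sub>i\<close> fixed; resetting
    its factor to 1 does not affect \<open>p\<close>, which is free of
    \<open>x\<^sub>i\<close>.\<close>
  define b' where "b' = b(i := 1)"
  have b': "b' l \<noteq> 0" for l using assms(3) by (simp add: b'_def)
  have "psubst (dilation b) p = psubst (dilation b') p"
    using assms(2) by (intro psubst_cong) (auto simp: dilation_def b'_def)
  moreover have "elementary i (psubst (dilation b') p) \<in> H"
  proof (rule elementary_conj[OF assms(1) _ dilation_inverse[OF b']])
    show "dilation b' \<in> H" by (intro subsetD[OF Aff_subset] dilation_in_Aff b')
    show "i \<notin> vars (dilation (\<lambda>i. inverse (b' i)) l)" if "l \<noteq> i" for l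
      using that vars_mult[of "Const (inverse (b' l))" "Var l"] by (auto simp: dilation_def)
  qed (simp_all add: dilation_def b'_def)
  ultimately show ?thesis by simp
qed

lemma elementary_add:
  "elementary i p \<in> H \<Longrightarrow> elementary i q \<in> H \<Longrightarrow> i \<notin> vars p \<Longrightarrow> elementary i (p + q) \<in> H"
  using comp_in_H[of "elementary i p" "elementary i q"] by (simp add: elementary_comp)

lemma elementary_monomial:
  assumes "elementary i p \<in> H" "i \<notin> vars p" "m \<in> keys p"
  shows "elementary i (single m 1) \<in> H"
proof -
  have "elementary i (single m 1) \<in> H \<and> i \<notin> vars (single m (1::'k))"
  \<comment> \<open>Freeness of \<open>x\<^sub>i\<close> is carried along in \<open>P\<close>, since
    adding, scaling and dilating shears all require it.\<close>
  proof (rule monomial_in_subspace[where P = "\<lambda>p. elementary i p \<in> H \<and> i \<notin> vars p"])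
    show "elementary i (p + q) \<in> H \<and> i \<notin> vars (p + q)"
      if "elementary i p \<in> H \<and> i \<notin> vars p" "elementary i q \<in> H \<and> i \<notin> vars q" for p q
      using that vars_add[of p q] elementary_add by blast
    show "elementary i (Const c * p) \<in> H \<and> i \<notin> vars (Const c * p)"
      if "elementary i p \<in> H \<and> i \<notin> vars p" for c p
      using that vars_mult[of "Const c" p] elementary_scale by auto
    show "elementary i (psubst (dilation b) p) \<in> H \<and> i \<notin> vars (psubst (dilation b) p)"
      if "elementary i p \<in> H \<and> i \<notin> vars p" "\<And>i. b i \<noteq> 0" for b p
    proof -
      have "keys (psubst (dilation b) p) \<subseteq> keys p"
        by (auto simp: in_keys_iff lookup_psubst_dilation)
      then have "vars (psubst (dilation b) p) \<subseteq> vars p" by (auto simp: vars_def)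
      then show ?thesis using that elementary_dilate by blast
    qed
  qed (use assms in auto)
  then show ?thesis ..
qed

text \<open>The substitution \<open>x\<^sub>j \<mapsto> x\<^sub>j + x\<^sub>l\<close> turns \<open>x\<^sub>j ^ (a + e)\<close> into a sum containing \<open>x\<^sub>j ^ a * x\<^sub>l ^ e\<close>.\<close>

lemma elementary_split_power:
  assumes H: "elementary i (single (single j (a + e) + r) 1) \<in> H"
    and "i \<noteq> j" "l \<noteq> i" "l \<noteq> j" "i \<notin> keys r" "j \<notin> keys r" "l \<notin> keys r"
  shows "elementary i (single (single j a + single l e + r) 1) \<in> H"
proof -
  define N where "N = a + e"
  define p :: "('n, 'k) mpoly" where "p = single (single j N + r) 1"
  let ?\<alpha> = "elementary j (Var l) :: ('n, 'k) endo"
  have i_p: "i \<notin> vars p"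
  proof -
    have "keys (single j N + r) \<subseteq> keys (single j N) \<union> keys r"
      by (rule Poly_Mapping.keys_add)
    also have "\<dots> \<subseteq> {j} \<union> keys r"
      by auto
    finally show ?thesis
      using vars_single[of "single j N + r" "1 :: 'k"] assms(2,5) unfolding p_def by blast
  qed
  have "elementary i (psubst ?\<alpha> p) \<in> H"
  proof (rule elementary_conj[where \<beta> = "elementary j (- Var l)"])
    show "elementary i p \<in> H" using H by (simp add: p_def N_def)
    show "?\<alpha> \<in> H"
      using assms by (intro subsetD[OF Aff_subset] elementary_in_Aff deg_le_Var) auto
    show "i \<notin> vars (elementary j (- Var l) x)" if "x \<noteq> i" for x
      using that assms vars_add[of "Var j" "- Var l"] by (auto simp: elementary_def)
  qed (use assms in \<open>simp_all add: elementary_inverse, simp_all add: elementary_def\<close>)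
  moreover have expand: "psubst ?\<alpha> p =
      (\<Sum>b\<le>N. single (single j b + single l (N - b) + r) (of_nat (N choose b)))"
  proof -
    have binomial_term: "(of_nat c :: ('n, 'k) mpoly) * Var j ^ b * Var l ^ d * single r 1 =
        single (single j b + single l d + r) (of_nat c)" for c b d
    proof -
      have "(of_nat c :: ('n, 'k) mpoly) = single 0 (of_nat c)"
        by (rule single_of_nat[symmetric])
      then show ?thesis
        by (simp only: Var_power mult_single add_0_left mult_1_right)
    qed
    have "monom_eval ?\<alpha> r = monom_eval Var r"
      unfolding monom_eval_def using assms(6) by (intro prod.cong) (auto simp: elementary_def)
    then have "psubst ?\<alpha> p = (Var j + Var l) ^ N * single r 1"
      by (simp add: p_def psubst.eval_hom_single monom_eval_add monom_eval_Var elementary_def)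
    also have "\<dots> = (\<Sum>b\<le>N. of_nat (N choose b) * Var j ^ b * Var l ^ (N - b) * single r 1)"
      by (simp add: binomial_ring sum_distrib_right)
    also have "\<dots> = (\<Sum>b\<le>N. single (single j b + single l (N - b) + r) (of_nat (N choose b)))"
      by (simp only: binomial_term)
    finally show ?thesis .
  qed
  moreover have "single j a + single l e + r \<in> keys (psubst ?\<alpha> p)"
  proof -
    \<comment> \<open>The exponents of \<open>x\<^sub>j\<close> tell the terms of the binomial
      expansion apart, so only \<open>b = a\<close> contributes; its coefficient
      \<open>N choose a\<close> is nonzero in characteristic zero.\<close>
    have "lookup (psubst ?\<alpha> p) (single j a + single l e + r) =
        (\<Sum>b\<le>N. if b = a then of_nat (N choose a) else 0)"
      unfolding expand lookup_sum
    proof (intro sum.cong refl)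
      fix b assume "b \<in> {..N}"
      have "single j b + single l (N - b) = single j a + single l e \<longleftrightarrow> b = a"
        using assms(4) by (auto simp: N_def lookup_add lookup_single when_def
            dest: arg_cong[where f = "\<lambda>x. lookup x j"])
      then show "lookup (single (single j b + single l (N - b) + r) (of_nat (N choose b)))
          (single j a + single l e + r) = (if b = a then of_nat (N choose a) else (0::'k))"
        by (auto simp: lookup_single when_def)
    qed
    then show ?thesis by (simp add: in_keys_iff N_def)
  qed
  moreover have "i \<notin> vars (psubst ?\<alpha> p)"
  proof -
    have "vars (psubst ?\<alpha> p) \<subseteq> {j, l} \<union> keys r"
      unfolding expand
    proof (rule order_trans[OF vars_sum], rule UN_least)
      fix b
      have "keys (single j b + single l (N - b)) \<subseteq> {j, l}"
        using Poly_Mapping.keys_add[of "single j b" "single l (N - b)"] by (auto split: if_splits)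
      then have "keys (single j b + single l (N - b) + r) \<subseteq> {j, l} \<union> keys r"
        using Poly_Mapping.keys_add[of "single j b + single l (N - b)" r] by blast
      then show "vars (single (single j b + single l (N - b) + r) (of_nat (N choose b) :: 'k))
          \<subseteq> {j, l} \<union> keys r"
        by (rule order_trans[OF vars_single])
    qed
    then show ?thesis using assms by auto
  qed
  ultimately show ?thesis
    using elementary_monomial by blast
qed

text \<open>Induction on the set of variables allowed besides \<open>x\<^sub>j\<close>: the exponent
  of a new variable is merged into that of \<open>x\<^sub>j\<close>, where the induction hypothesis
  applies, and \<open>elementary_split_power\<close> separates the two again.\<close>

lemma all_monomial_shears:
  assumes "i \<noteq> j" "elementary i (Var j ^ 2) \<in> H" "i \<notin> keys m"
  shows "elementary i (single m 1) \<in> H"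
proof -
  have "elementary i (single m 1) \<in> H" if "finite S" "i \<notin> S" "j \<notin> S" "keys m \<subseteq> insert j S" for S m
    using that
  proof (induction S arbitrary: m rule: finite_induct)
    case empty
    then have "m = single j (lookup m j)"
      by (intro poly_mapping_eqI) (auto simp: lookup_single when_def in_keys_iff subset_iff)
    then show ?case
      using power_shears[OF assms(1,2), of "lookup m j"] by (simp add: Var_power)
  next
    case (insert l S)
    define r where "r = (\<Sum>x\<in>S. single x (lookup m x))"
    have r: "lookup r x = (if x \<in> S then lookup m x else 0)" for x
      using insert.hyps(1) by (simp add: r_def lookup_sum lookup_single when_def)
    then have keys_r: "keys r \<subseteq> S" by (auto simp: in_keys_iff split: if_splits)
    let ?a = "lookup m j" and ?e = "lookup m l"
    have "m = single j ?a + single l ?e + r"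
      using insert.hyps insert.prems
      by (intro poly_mapping_eqI) (auto simp: lookup_add lookup_single when_def r in_keys_iff subset_iff)
    moreover have "keys (single j (?a + ?e) + r) \<subseteq> insert j S"
      using keys_r by (intro order_trans[OF Poly_Mapping.keys_add]) auto
    then have "elementary i (single (single j (?a + ?e) + r) 1) \<in> H"
      using insert.prems by (intro insert.IH) auto
    then have "elementary i (single (single j ?a + single l ?e + r) 1) \<in> H"
      using assms(1) insert.hyps insert.prems keys_r by (intro elementary_split_power) auto
    ultimately show ?case by simp
  qed
  from this[of "UNIV - {i, j}" m] show ?thesis
    using assms(1,3) by auto
qed

lemma all_shears_at:
  assumes "i \<noteq> j" "elementary i (Var j ^ 2) \<in> H" "i \<notin> vars p"
  shows "elementary i p \<in> H"
proof -
  have "elementary i (\<Sum>m\<in>A. single m (lookup p m)) \<in> H" if "finite A" "A \<subseteq> keys p" for A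
    using that
  proof (induction A)
    case (insert m A)
    have i_m: "i \<notin> keys m" using insert.prems assms(3) by (auto simp: vars_def)
    have "i \<notin> vars (single m (1::'k))" "i \<notin> vars (single m (lookup p m))"
      using vars_single[of m "1::'k"] vars_single[of m "lookup p m"] i_m by auto
    moreover have "Const (lookup p m) * single m 1 = single m (lookup p m)"
      by (simp add: Const_def mult_single)
    ultimately have "elementary i (single m (lookup p m)) \<in> H"
      using elementary_scale[OF all_monomial_shears[OF assms(1,2) i_m], of "lookup p m"] by simp
    then show ?case
      using insert \<open>i \<notin> vars (single m (lookup p m))\<close> by (simp add: elementary_add)
  qed (simp add: Var_in_H)
  from this[OF finite_keys subset_refl] show ?thesis
    unfolding mpoly_sum_single[of p, symmetric] .
qed

text \<open>Conjugation by the transposition of \<open>i\<close> and \<open>i'\<close> carries the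
  quadratic shear over to component \<open>i'\<close>.\<close>

lemma all_shears:
  assumes "i \<noteq> j" "elementary i (Var j ^ 2) \<in> H" "i' \<notin> vars p"
  shows "elementary i' p \<in> H"
proof (rule all_shears_at)
  define g where "g = (\<lambda>x. if x = i then i' else if x = i' then i else x)"
  define \<pi> :: "('n, 'k) endo" where "\<pi> = (\<lambda>l. Var (g l))"
  have g: "g (g x) = x" for x by (simp add: g_def)
  show "i' \<noteq> g j" using assms(1) by (auto simp: g_def)
  have "\<pi> \<in> H"
    unfolding \<pi>_def using g by (intro subsetD[OF Aff_subset] permutation_in_Aff) auto
  moreover have "\<pi> \<bullet> (elementary i (Var j ^ 2) \<bullet> \<pi>) = elementary i' (Var (g j) ^ 2)"
  proof
    fix l
    have "g l = i \<longleftrightarrow> l = i'" by (auto simp: g_def)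
    moreover have "g i = i'" by (simp add: g_def)
    ultimately show "(\<pi> \<bullet> (elementary i (Var j ^ 2) \<bullet> \<pi>)) l = elementary i' (Var (g j) ^ 2) l"
      by (auto simp: \<pi>_def comp_def elementary_def psubst_simps g)
  qed
  ultimately show "elementary i' (Var (g j) ^ 2) \<in> H"
    using assms(2) by (metis comp_in_H)
qed (rule assms(3))

end

section \<open>Triangular automorphisms and the tame subgroup\<close>

text \<open>After splitting off its diagonal part, a triangular automorphism is a product of shears,
  one for each variable.\<close>

lemma triangular_in_subgroup:
  fixes H :: "('n::{finite, linorder}, 'k::field_char_0) endo set"
  assumes "closed_subgroup_above_Aff H" and shears: "\<And>i p. i \<notin> vars p \<Longrightarrow> elementary i p \<in> H"
  shows "BA \<subseteq> H"
proof
  interpret closed_subgroup_above_Aff H by fact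
  fix \<sigma> :: "('n, 'k) endo" assume "\<sigma> \<in> BA"
  then obtain \<alpha> p where \<alpha>: "\<And>i. \<alpha> i \<noteq> 0" and p: "\<And>i. vars (p i) \<subseteq> {j. i < j}"
    and \<sigma>: "\<And>i. \<sigma> i = Const (\<alpha> i) * Var i + p i"
    by (auto simp: BA_def)
  define q where "q = (\<lambda>i. Const (inverse (\<alpha> i)) * p i)"
  have q: "vars (q i) \<subseteq> {j. i < j}" for i
    unfolding q_def using vars_mult[of "Const (inverse (\<alpha> i))" "p i"] p[of i] by auto
  define F where "F = (\<lambda>S i. if i \<in> S then Var i + q i else Var i)"
  have "F S \<in> H" if "finite S" for S
    using that
  proof (induction S rule: finite_linorder_min_induct)
    case empty
    then show ?case by (simp add: F_def Var_in_H)
  next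
    case (insert i S)
    \<comment> \<open>The new index \<open>i\<close> lies below all of \<open>S\<close>, and each
      \<open>q l\<close> involves only variables above \<open>l\<close>; hence the shear of
      \<open>x\<^sub>i\<close> leaves \<open>q l\<close> unchanged.\<close>
    have "F (insert i S) = F S \<bullet> elementary i (q i)"
    proof
      fix l
      have "psubst (elementary i (q i)) (q l) = q l" if "l \<in> S"
      proof (rule psubst_elementary)
        have "i < l" using insert.hyps(2) that by blast
        then show "i \<notin> vars (q l)" using q[of l] order.asym by blast
      qed
      moreover have "i \<notin> S" using insert.hyps(2) by auto
      ultimately show "F (insert i S) l = (F S \<bullet> elementary i (q i)) l"
        by (auto simp: F_def comp_def psubst_simps) (auto simp: elementary_def)
    qed
    moreover have "elementary i (q i) \<in> H"
      using q[of i] by (intro shears) auto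
    ultimately show ?case using insert.IH by (simp add: comp_in_H)
  qed
  then have "F UNIV \<in> H" by simp
  then have "dilation \<alpha> \<bullet> F UNIV \<in> H"
    by (intro comp_in_H[OF subsetD[OF Aff_subset dilation_in_Aff]] \<alpha>)
  moreover have "dilation \<alpha> \<bullet> F UNIV = \<sigma>"
    using \<alpha> by (simp add: dilation_comp_left F_def fun_eq_iff \<sigma> q_def distrib_left
        flip: mult.assoc Const_mult)
  ultimately show "\<sigma> \<in> H" by simp
qed

theorem theorem1p2:
  fixes H :: "('n::{finite, linorder}, 'k::{alg_closed_field, field_char_0}) endo set"
  assumes "CARD('n) \<ge> 2"
    and "subgroup H GA"
    and "closedin (subtopology End_topology (carrier GA)) H"
    and "Aff \<subset> H"
  shows "TA \<subseteq> H"
proof -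
  have H: "closed_subgroup_above_Aff H"
    using assms by (intro closed_subgroup_above_Aff.intro) auto
  obtain h where "h \<in> H" "h \<notin> Aff" using assms(4) by blast
  \<comment> \<open>Any coordinate may serve as \<open>j\<close>; \<open>undefined\<close> is just
    some element of the index type.\<close>
  then obtain i where "i \<noteq> undefined" "elementary i (Var undefined ^ 2) \<in> H"
    using quadratic_shear_exists[OF H] by blast
  then have "elementary l p \<in> H" if "l \<notin> vars p" for l p
    using closed_subgroup_above_Aff.all_shears[OF H] that by blast
  then have "BA \<subseteq> H"
    by (rule triangular_in_subgroup[OF H])
  then show ?thesis
    unfolding TA_def using assms(2,4) by (intro group.generate_subgroup_incl[OF group_GA]) auto
qed

end
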